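(* Let $M$ be a smooth manifold, $h$ a non-degenerate $(0,2)$-tensor field on $M$ which is symmetric or skew-symmetric, and $\nabla$ an affine connection on $M$. Let $$\check h(X+\alpha,Y+\beta)=h(X,Y)+h(h^{-1}(\alpha),h^{-1}(\beta)),\qquad \hat\nabla_{X+\alpha}(Y+\beta)=\nabla_XY+h(\nabla_X(h^{-1}(\beta)))$$ on $TM\oplus T^*M$. Then $(TM\oplus T^*M,\check h,\hat\nabla)$ is a generalized quasi-statistical manifold (that is, $d^{\hat\nabla}\check h=0$, with the torsion of $\hat\nabla$ defined through the bracket $[\cdot,\cdot]_\nabla$) if and only if $(M,h,\nabla)$ is a quasi-statistical manifold.
   Context: $C^\infty(E)$ denotes smooth sections of $E$. An affine connection $\nabla$ on $M$ may have torsion $T^\nabla(X,Y)=\nabla_XY-\nabla_YX-[X,Y]$; $(\nabla_X\beta)(Y)=X(\beta(Y))-\beta(\nabla_XY)$ for 1-forms $\beta$. $h$ also denotes the isomorphism $TM\to T^*M$, $h(X)=h(X,\cdot)$, with inverse $h^{-1}$. $(M,h,\nabla)$ is a quasi-statistical manifold if $d^\nabla h=0$, where $(d^\nabla h)(X,Y,Z)=(\nabla_Xh)(Y,Z)-(\nabla_Yh)(X,Z)+h(T^\nabla(X,Y),Z)$. An affine connection $D$ on $TM\oplus T^*M$ is an $\mathbb R$-bilinear map $(\sigma,\tau)\mapsto D_\sigma\tau$ on $C^\infty(TM\oplus T^*M)$ with $D_{f\sigma}\tau=fD_\sigma\tau$ and $D_\sigma(f\tau)=\sigma(f)\tau+fD_\sigma\tau$,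 where $(X+\alpha)(f)=X(f)$. Its torsion is $T^D(\sigma,\tau)=D_\sigma\tau-D_\tau\sigma-[\sigma,\tau]_\nabla$, where $[X+\alpha,Y+\beta]_\nabla=[X,Y]+\nabla_X\beta-\nabla_Y\alpha$. For a non-degenerate bilinear form $k$ on $TM\oplus T^*M$, $(k,D)$ is a generalized quasi-statistical structure if $d^Dk=0$, where $(d^Dk)(\sigma,\tau,\nu)=(D_\sigma k)(\tau,\nu)-(D_\tau k)(\sigma,\nu)+k(T^D(\sigma,\tau),\nu)$ and $(D_\sigma k)(\tau,\nu)=\sigma(k(\tau,\nu))-k(D_\sigma\tau,\nu)-k(\tau,D_\sigma\nu)$. *)

theory Defs
  imports "HOL-Analysis.Analysis" "HOL-Library.Function_Algebras"
begin

text \<open>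
  Sums, differences and products of functions are pointwise (theory
  \<^theory>\<open>HOL-Library.Function_Algebras\<close>). This gives the addition of tangent vectors, of
  covectors, of real functions on the manifold, and of sections.
\<close>


section \<open>Smooth manifolds\<close>

text \<open>For open \<open>S\<close> in a finite-dimensional space this is the usual class of \<open>C\<^sup>k\<close> maps.\<close>

primrec C_on :: "nat \<Rightarrow> 'a::real_normed_vector set \<Rightarrow> ('a \<Rightarrow> 'b::real_normed_vector) \<Rightarrow> bool" where
  "C_on 0 S f \<longleftrightarrow> continuous_on S f"
| "C_on (Suc k) S f \<longleftrightarrow> (\<forall>x\<in>S. f differentiable (at x)) \<and>
     (\<forall>v. C_on k S (\<lambda>x. frechet_derivative f (at x) v))"

definition smooth_on :: "'a::real_normed_vector set \<Rightarrow> ('a \<Rightarrow> 'b::real_normed_vector) \<Rightarrow> bool" where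
  "smooth_on S f \<longleftrightarrow> (\<forall>k. C_on k S f)"

text \<open>A chart is a coordinate domain together with its coordinate map.\<close>

type_synonym ('m, 'e) chart = "'m set \<times> ('m \<Rightarrow> 'e)"

text \<open>
  The manifold is the whole type \<open>'m\<close>, modelled on the Euclidean space \<open>'e\<close>. The Hausdorff and
  second countability axioms are sort constraints on \<open>'m\<close>. The atlas need not be maximal.
\<close>

definition smooth_atlas ::
  "('m::{t2_space, second_countable_topology}, 'e::euclidean_space) chart set \<Rightarrow> bool" where
  "smooth_atlas A \<longleftrightarrow>
     (\<Union>(U, \<phi>)\<in>A. U) = UNIV \<and>
     (\<forall>(U, \<phi>)\<in>A. open U \<and> open (\<phi> ` U) \<and> homeomorphism U (\<phi> ` U) \<phi> (inv_into U \<phi>)) \<and>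
     (\<forall>(U, \<phi>)\<in>A. \<forall>(V, \<psi>)\<in>A. smooth_on (\<phi> ` (U \<inter> V)) (\<psi> \<circ> inv_into U \<phi>))"

definition smooth_functions :: "('m, 'e::euclidean_space) chart set \<Rightarrow> ('m \<Rightarrow> real) set" where
  "smooth_functions A = {f. \<forall>(U, \<phi>)\<in>A. smooth_on (\<phi> ` U) (f \<circ> inv_into U \<phi>)}"


section \<open>Tangent and cotangent spaces, vector fields and 1-forms\<close>

type_synonym 'm tvec = "('m \<Rightarrow> real) \<Rightarrow> real"
type_synonym 'm covec = "'m tvec \<Rightarrow> real"
type_synonym 'm vfield = "'m \<Rightarrow> 'm tvec"
type_synonym 'm form = "'m \<Rightarrow> 'm covec"

definition scale :: "real \<Rightarrow> ('x \<Rightarrow> real) \<Rightarrow> 'x \<Rightarrow> real" where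
  "scale c u = (\<lambda>x. c * u x)"

text \<open>
  Tangent vectors are point derivations of the algebra of smooth functions, and covectors are
  linear functionals on the tangent space. Both are extended by 0 outside their domain, so that
  equality of functions is equality of vectors.
\<close>

definition tangent_space :: "('m, 'e::euclidean_space) chart set \<Rightarrow> 'm \<Rightarrow> 'm tvec set" where
  "tangent_space A p = {v.
     (\<forall>f\<in>smooth_functions A. \<forall>g\<in>smooth_functions A. v (f + g) = v f + v g) \<and>
     (\<forall>c. \<forall>f\<in>smooth_functions A. v (scale c f) = c * v f) \<and>
     (\<forall>f\<in>smooth_functions A. \<forall>g\<in>smooth_functions A. v (f * g) = f p * v g + g p * v f) \<and>
     (\<forall>f. f \<notin> smooth_functions A \<longrightarrow> v f = 0)}"

definition cotangent_space :: "('m, 'e::euclidean_space) chart set \<Rightarrow> 'm \<Rightarrow> 'm covec set" where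
  "cotangent_space A p = {a.
     (\<forall>u\<in>tangent_space A p. \<forall>v\<in>tangent_space A p. a (u + v) = a u + a v) \<and>
     (\<forall>c. \<forall>u\<in>tangent_space A p. a (scale c u) = c * a u) \<and>
     (\<forall>u. u \<notin> tangent_space A p \<longrightarrow> a u = 0)}"

definition act :: "'m vfield \<Rightarrow> ('m \<Rightarrow> real) \<Rightarrow> 'm \<Rightarrow> real" where
  "act X f = (\<lambda>p. X p f)"

definition eval_form :: "'m form \<Rightarrow> 'm vfield \<Rightarrow> 'm \<Rightarrow> real" where
  "eval_form \<alpha> X = (\<lambda>p. \<alpha> p (X p))"

definition vector_fields :: "('m, 'e::euclidean_space) chart set \<Rightarrow> 'm vfield set" where
  "vector_fields A = {X. (\<forall>p. X p \<in> tangent_space A p) \<and>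
     (\<forall>f\<in>smooth_functions A. act X f \<in> smooth_functions A)}"

definition one_forms :: "('m, 'e::euclidean_space) chart set \<Rightarrow> 'm form set" where
  "one_forms A = {\<alpha>. (\<forall>p. \<alpha> p \<in> cotangent_space A p) \<and>
     (\<forall>X\<in>vector_fields A. eval_form \<alpha> X \<in> smooth_functions A)}"

definition smul :: "('m \<Rightarrow> real) \<Rightarrow> ('m \<Rightarrow> 'x \<Rightarrow> real) \<Rightarrow> 'm \<Rightarrow> 'x \<Rightarrow> real" where
  "smul f s = (\<lambda>p. scale (f p) (s p))"

definition lie_bracket :: "'m vfield \<Rightarrow> 'm vfield \<Rightarrow> 'm vfield" where
  "lie_bracket X Y = (\<lambda>p f. X p (act Y f) - Y p (act X f))"


section \<open>Tensor fields of type (0,2)\<close>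

text \<open>In the form \<open>h p u v\<close>, the covector \<open>h p u\<close> is \<open>h\<^sub>p(u, \<cdot>)\<close>.\<close>

type_synonym 'm tensor02 = "'m \<Rightarrow> 'm tvec \<Rightarrow> 'm covec"

definition eval02 :: "'m tensor02 \<Rightarrow> 'm vfield \<Rightarrow> 'm vfield \<Rightarrow> 'm \<Rightarrow> real" where
  "eval02 h X Y = (\<lambda>p. h p (X p) (Y p))"

definition tensor02_field ::
  "('m, 'e::euclidean_space) chart set \<Rightarrow> 'm tensor02 \<Rightarrow> bool" where
  "tensor02_field A h \<longleftrightarrow>
     (\<forall>p. \<forall>u\<in>tangent_space A p. h p u \<in> cotangent_space A p) \<and>
     (\<forall>p. \<forall>u\<in>tangent_space A p. \<forall>v\<in>tangent_space A p. h p (u + v) = h p u + h p v) \<and>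
     (\<forall>p c. \<forall>u\<in>tangent_space A p. h p (scale c u) = scale c (h p u)) \<and>
     (\<forall>X\<in>vector_fields A. \<forall>Y\<in>vector_fields A. eval02 h X Y \<in> smooth_functions A)"

definition symmetric_field ::
  "('m, 'e::euclidean_space) chart set \<Rightarrow> 'm tensor02 \<Rightarrow> bool" where
  "symmetric_field A h \<longleftrightarrow>
     (\<forall>p. \<forall>u\<in>tangent_space A p. \<forall>v\<in>tangent_space A p. h p u v = h p v u)"

definition skew_symmetric_field ::
  "('m, 'e::euclidean_space) chart set \<Rightarrow> 'm tensor02 \<Rightarrow> bool" where
  "skew_symmetric_field A h \<longleftrightarrow>
     (\<forall>p. \<forall>u\<in>tangent_space A p. \<forall>v\<in>tangent_space A p. h p u v = - h p v u)"

definition nondegenerate ::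
  "('m, 'e::euclidean_space) chart set \<Rightarrow> 'm tensor02 \<Rightarrow> bool" where
  "nondegenerate A h \<longleftrightarrow>
     (\<forall>p. \<forall>u\<in>tangent_space A p. (\<forall>v\<in>tangent_space A p. h p u v = 0) \<longrightarrow> u = 0)"

definition flat :: "'m tensor02 \<Rightarrow> 'm vfield \<Rightarrow> 'm form" where
  "flat h X = (\<lambda>p. h p (X p))"

definition sharp_at ::
  "('m, 'e::euclidean_space) chart set \<Rightarrow> 'm tensor02 \<Rightarrow> 'm \<Rightarrow> 'm covec \<Rightarrow> 'm tvec" where
  "sharp_at A h p = inv_into (tangent_space A p) (h p)"

definition sharp ::
  "('m, 'e::euclidean_space) chart set \<Rightarrow> 'm tensor02 \<Rightarrow> 'm form \<Rightarrow> 'm vfield" where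
  "sharp A h \<alpha> = (\<lambda>p. sharp_at A h p (\<alpha> p))"


section \<open>Affine connections and quasi-statistical structures\<close>

type_synonym 'm connection = "'m vfield \<Rightarrow> 'm vfield \<Rightarrow> 'm vfield"

definition affine_connection ::
  "('m, 'e::euclidean_space) chart set \<Rightarrow> 'm connection \<Rightarrow> bool" where
  "affine_connection A N \<longleftrightarrow>
     (\<forall>X\<in>vector_fields A. \<forall>Y\<in>vector_fields A. N X Y \<in> vector_fields A) \<and>
     (\<forall>X\<in>vector_fields A. \<forall>X'\<in>vector_fields A. \<forall>Y\<in>vector_fields A.
        N (X + X') Y = N X Y + N X' Y) \<and>
     (\<forall>X\<in>vector_fields A. \<forall>Y\<in>vector_fields A. \<forall>Y'\<in>vector_fields A.
        N X (Y + Y') = N X Y + N X Y') \<and>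
     (\<forall>c. \<forall>X\<in>vector_fields A. \<forall>Y\<in>vector_fields A.
        N (smul (\<lambda>_. c) X) Y = smul (\<lambda>_. c) (N X Y) \<and>
        N X (smul (\<lambda>_. c) Y) = smul (\<lambda>_. c) (N X Y)) \<and>
     (\<forall>f\<in>smooth_functions A. \<forall>X\<in>vector_fields A. \<forall>Y\<in>vector_fields A.
        N (smul f X) Y = smul f (N X Y) \<and>
        N X (smul f Y) = smul (act X f) Y + smul f (N X Y))"

definition torsion :: "'m connection \<Rightarrow> 'm vfield \<Rightarrow> 'm vfield \<Rightarrow> 'm vfield" where
  "torsion N X Y = N X Y - N Y X - lie_bracket X Y"

definition cov_form ::
  "('m, 'e::euclidean_space) chart set \<Rightarrow> 'm connection \<Rightarrow> 'm vfield \<Rightarrow> 'm form \<Rightarrow> 'm form" where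
  "cov_form A N X \<beta> = (THE \<gamma>. \<gamma> \<in> one_forms A \<and>
     (\<forall>Y\<in>vector_fields A. eval_form \<gamma> Y = act X (eval_form \<beta> Y) - eval_form \<beta> (N X Y)))"

definition cov_tensor ::
  "'m connection \<Rightarrow> 'm tensor02 \<Rightarrow> 'm vfield \<Rightarrow> 'm vfield \<Rightarrow> 'm vfield \<Rightarrow> 'm \<Rightarrow> real" where
  "cov_tensor N h X Y Z = act X (eval02 h Y Z) - eval02 h (N X Y) Z - eval02 h Y (N X Z)"

definition d_tensor ::
  "'m connection \<Rightarrow> 'm tensor02 \<Rightarrow> 'm vfield \<Rightarrow> 'm vfield \<Rightarrow> 'm vfield \<Rightarrow> 'm \<Rightarrow> real" where
  "d_tensor N h X Y Z = cov_tensor N h X Y Z - cov_tensor N h Y X Z + eval02 h (torsion N X Y) Z"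

definition quasi_statistical ::
  "('m, 'e::euclidean_space) chart set \<Rightarrow> 'm tensor02 \<Rightarrow> 'm connection \<Rightarrow> bool" where
  "quasi_statistical A h N \<longleftrightarrow>
     tensor02_field A h \<and> nondegenerate A h \<and> affine_connection A N \<and>
     (\<forall>X\<in>vector_fields A. \<forall>Y\<in>vector_fields A. \<forall>Z\<in>vector_fields A. d_tensor N h X Y Z = 0)"


section \<open>The generalized tangent bundle\<close>

text \<open>A section \<open>X + \<alpha>\<close> of the sum of tangent and cotangent bundle is the pair \<open>(X, \<alpha>)\<close>.\<close>

type_synonym 'm gvec = "'m tvec \<times> 'm covec"
type_synonym 'm gsection = "'m vfield \<times> 'm form"
type_synonym 'm gbilinear = "'m \<Rightarrow> 'm gvec \<Rightarrow> 'm gvec \<Rightarrow> real"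
type_synonym 'm gconnection = "'m gsection \<Rightarrow> 'm gsection \<Rightarrow> 'm gsection"

definition gspace :: "('m, 'e::euclidean_space) chart set \<Rightarrow> 'm \<Rightarrow> 'm gvec set" where
  "gspace A p = tangent_space A p \<times> cotangent_space A p"

definition gsections :: "('m, 'e::euclidean_space) chart set \<Rightarrow> 'm gsection set" where
  "gsections A = vector_fields A \<times> one_forms A"

definition gscale :: "real \<Rightarrow> 'm gvec \<Rightarrow> 'm gvec" where
  "gscale c x = (scale c (fst x), scale c (snd x))"

definition gsmul :: "('m \<Rightarrow> real) \<Rightarrow> 'm gsection \<Rightarrow> 'm gsection" where
  "gsmul f \<sigma> = (smul f (fst \<sigma>), smul f (snd \<sigma>))"

definition gact :: "'m gsection \<Rightarrow> ('m \<Rightarrow> real) \<Rightarrow> 'm \<Rightarrow> real" where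
  "gact \<sigma> f = act (fst \<sigma>) f"

definition geval :: "'m gbilinear \<Rightarrow> 'm gsection \<Rightarrow> 'm gsection \<Rightarrow> 'm \<Rightarrow> real" where
  "geval k \<sigma> \<tau> = (\<lambda>p. k p (fst \<sigma> p, snd \<sigma> p) (fst \<tau> p, snd \<tau> p))"

definition gbilinear_form ::
  "('m, 'e::euclidean_space) chart set \<Rightarrow> 'm gbilinear \<Rightarrow> bool" where
  "gbilinear_form A k \<longleftrightarrow>
     (\<forall>p. \<forall>x\<in>gspace A p. \<forall>y\<in>gspace A p. \<forall>z\<in>gspace A p.
        k p (x + y) z = k p x z + k p y z \<and> k p z (x + y) = k p z x + k p z y) \<and>
     (\<forall>p c. \<forall>x\<in>gspace A p. \<forall>y\<in>gspace A p.
        k p (gscale c x) y = c * k p x y \<and> k p x (gscale c y) = c * k p x y) \<and>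
     (\<forall>\<sigma>\<in>gsections A. \<forall>\<tau>\<in>gsections A. geval k \<sigma> \<tau> \<in> smooth_functions A)"

definition gnondegenerate ::
  "('m, 'e::euclidean_space) chart set \<Rightarrow> 'm gbilinear \<Rightarrow> bool" where
  "gnondegenerate A k \<longleftrightarrow>
     (\<forall>p. \<forall>x\<in>gspace A p. (\<forall>y\<in>gspace A p. k p x y = 0) \<longrightarrow> x = 0)"

definition gaffine_connection ::
  "('m, 'e::euclidean_space) chart set \<Rightarrow> 'm gconnection \<Rightarrow> bool" where
  "gaffine_connection A D \<longleftrightarrow>
     (\<forall>\<sigma>\<in>gsections A. \<forall>\<tau>\<in>gsections A. D \<sigma> \<tau> \<in> gsections A) \<and>
     (\<forall>\<sigma>\<in>gsections A. \<forall>\<sigma>'\<in>gsections A. \<forall>\<tau>\<in>gsections A.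
        D (\<sigma> + \<sigma>') \<tau> = D \<sigma> \<tau> + D \<sigma>' \<tau>) \<and>
     (\<forall>\<sigma>\<in>gsections A. \<forall>\<tau>\<in>gsections A. \<forall>\<tau>'\<in>gsections A.
        D \<sigma> (\<tau> + \<tau>') = D \<sigma> \<tau> + D \<sigma> \<tau>') \<and>
     (\<forall>c. \<forall>\<sigma>\<in>gsections A. \<forall>\<tau>\<in>gsections A.
        D (gsmul (\<lambda>_. c) \<sigma>) \<tau> = gsmul (\<lambda>_. c) (D \<sigma> \<tau>) \<and>
        D \<sigma> (gsmul (\<lambda>_. c) \<tau>) = gsmul (\<lambda>_. c) (D \<sigma> \<tau>)) \<and>
     (\<forall>f\<in>smooth_functions A. \<forall>\<sigma>\<in>gsections A. \<forall>\<tau>\<in>gsections A.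
        D (gsmul f \<sigma>) \<tau> = gsmul f (D \<sigma> \<tau>) \<and>
        D \<sigma> (gsmul f \<tau>) = gsmul (gact \<sigma> f) \<tau> + gsmul f (D \<sigma> \<tau>))"

definition gbracket ::
  "('m, 'e::euclidean_space) chart set \<Rightarrow> 'm connection \<Rightarrow> 'm gconnection" where
  "gbracket A N \<sigma> \<tau> =
     (lie_bracket (fst \<sigma>) (fst \<tau>), cov_form A N (fst \<sigma>) (snd \<tau>) - cov_form A N (fst \<tau>) (snd \<sigma>))"

definition gtorsion ::
  "('m, 'e::euclidean_space) chart set \<Rightarrow> 'm connection \<Rightarrow> 'm gconnection \<Rightarrow> 'm gconnection" where
  "gtorsion A N D \<sigma> \<tau> = D \<sigma> \<tau> - D \<tau> \<sigma> - gbracket A N \<sigma> \<tau>"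

definition gcov_bilinear ::
  "'m gconnection \<Rightarrow> 'm gbilinear \<Rightarrow> 'm gsection \<Rightarrow> 'm gsection \<Rightarrow> 'm gsection \<Rightarrow> 'm \<Rightarrow> real" where
  "gcov_bilinear D k \<sigma> \<tau> \<nu> = gact \<sigma> (geval k \<tau> \<nu>) - geval k (D \<sigma> \<tau>) \<nu> - geval k \<tau> (D \<sigma> \<nu>)"

definition gd_bilinear ::
  "('m, 'e::euclidean_space) chart set \<Rightarrow> 'm connection \<Rightarrow> 'm gconnection \<Rightarrow> 'm gbilinear \<Rightarrow>
   'm gsection \<Rightarrow> 'm gsection \<Rightarrow> 'm gsection \<Rightarrow> 'm \<Rightarrow> real" where
  "gd_bilinear A N D k \<sigma> \<tau> \<nu> =
     gcov_bilinear D k \<sigma> \<tau> \<nu> - gcov_bilinear D k \<tau> \<sigma> \<nu> + geval k (gtorsion A N D \<sigma> \<tau>) \<nu>"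

text \<open>The connection \<open>N\<close> on the manifold enters only through the bracket in the torsion of \<open>D\<close>.\<close>

definition gquasi_statistical ::
  "('m, 'e::euclidean_space) chart set \<Rightarrow> 'm connection \<Rightarrow> 'm gbilinear \<Rightarrow> 'm gconnection \<Rightarrow> bool"
  where
  "gquasi_statistical A N k D \<longleftrightarrow>
     gbilinear_form A k \<and> gnondegenerate A k \<and> gaffine_connection A D \<and>
     (\<forall>\<sigma>\<in>gsections A. \<forall>\<tau>\<in>gsections A. \<forall>\<nu>\<in>gsections A. gd_bilinear A N D k \<sigma> \<tau> \<nu> = 0)"

definition h_check ::
  "('m, 'e::euclidean_space) chart set \<Rightarrow> 'm tensor02 \<Rightarrow> 'm gbilinear" where
  "h_check A h p x y =
     h p (fst x) (fst y) + h p (sharp_at A h p (snd x)) (sharp_at A h p (snd y))"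

definition nabla_hat ::
  "('m, 'e::euclidean_space) chart set \<Rightarrow> 'm tensor02 \<Rightarrow> 'm connection \<Rightarrow> 'm gconnection" where
  "nabla_hat A h N \<sigma> \<tau> =
     (N (fst \<sigma>) (fst \<tau>), flat h (N (fst \<sigma>) (sharp A h (snd \<tau>))))"

end

theory Submission
  imports Defs
begin

text \<open>
  Write \<open>\<sigma> = X + h(V)\<close>, \<open>\<tau> = Y + h(W)\<close>, \<open>\<nu> = Z + h(U)\<close>. Since
  \<open>\<nabla>\<^sub>X (h(W)) = (\<nabla>\<^sub>X h)(W, \<cdot>) + h(\<nabla>\<^sub>X W)\<close>, the cotangent part of the torsion contributes
  \<open>(\<nabla>\<^sub>Y h)(V, U) - (\<nabla>\<^sub>X h)(W, U)\<close>, which cancels the cotangent part of the covariant derivatives of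
  the form. What remains is \<open>d\<^sup>\<nabla>h(X, Y, Z)\<close>.

  The analytic content is that \<open>h\<close> is an isomorphism of bundles and that \<open>\<nabla>\<^sub>X \<beta>\<close> is a one-form.
  Hadamard's lemma and bump functions give local frames of globally defined vector fields.
  Injectivity of \<open>h\<close> on the finite-dimensional tangent spaces then gives bijectivity, \<open>h\<^sup>-\<^sup>1\<close>
  preserves smoothness by Gaussian elimination with smooth coefficients, and \<open>\<nabla>\<^sub>X \<beta>\<close> is a one-form
  because it is linear over the smooth functions in its argument.
\<close>

section \<open>Calculus of smooth maps on open sets\<close>

text \<open>Two notions are empty until existence and uniqueness are proved: \<open>sharp_at\<close>
  is an \<open>inv_into\<close> on the tangent space, and \<open>cov_form\<close> is a
  \<open>THE\<close>. Both need a large supply of global vector fields. Tangent vectors are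
  derivations of the globally smooth functions, so coordinate functions and coordinate fields, which
  live on one chart, can be used only after multiplication by a bump function; this is the origin of
  the factors \<kappa> p in the constants below. The frame coefficients of h^-1(\<beta>) are first
  known only as a pointwise solution of a linear system. For this reason elimination is formulated
  for a given solution about which no smoothness is assumed. The generalized tensor turns out to
  depend only on the vector parts X, Y, Z, for arbitrary forms, so one identity serves both
  directions of the equivalence.\<close>

lemma C_on_subset: "C_on k S f \<Longrightarrow> T \<subseteq> S \<Longrightarrow> C_on k T f"
  by (induction k arbitrary: f) (auto intro: continuous_on_subset)

lemma C_on_SucD: "C_on (Suc k) S f \<Longrightarrow> C_on k S f"
proof (induction k arbitrary: f)
  case 0
  then show ?case
    by (auto intro!: differentiable_imp_continuous_on differentiable_at_imp_differentiable_on)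
next
  case (Suc k)
  then show ?case by (metis C_on.simps(2))
qed

text \<open>On an open set, agreement of values forces agreement of Frechet derivatives at every
  point, so the induction can pass to the directional derivatives.\<close>

lemma C_on_cong:
  assumes "open S" "C_on k S f" "\<And>x. x \<in> S \<Longrightarrow> f x = g x"
  shows "C_on k S g"
  using assms(2,3)
proof (induction k arbitrary: f g)
  case 0
  then show ?case by (metis C_on.simps(1) continuous_on_cong)
next
  case (Suc k)
  have d: "(g has_derivative frechet_derivative f (at x)) (at x)" if "x \<in> S" for x
    using Suc.prems that \<open>open S\<close>
    by (auto simp: frechet_derivative_works intro: has_derivative_transform_within_open)
  then have e: "frechet_derivative g (at x) = frechet_derivative f (at x)" if "x \<in> S" for x
    using frechet_derivative_at that by metis
  have "C_on k S (\<lambda>x. frechet_derivative g (at x) v)" for v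
    using Suc.IH[of "\<lambda>x. frechet_derivative f (at x) v" "\<lambda>x. frechet_derivative g (at x) v"]
      Suc.prems e by auto
  then show ?case using d by (auto intro: differentiableI)
qed

text \<open>\<open>C_on\<close> is phrased with \<open>frechet_derivative\<close>, which is a choice
  operator. This rule allows any explicitly given derivative to be exhibited instead.\<close>

lemma C_on_SucI:
  assumes "open S" "\<And>x. x \<in> S \<Longrightarrow> (f has_derivative f' x) (at x)"
    and "\<And>v. C_on k S (\<lambda>x. f' x v)"
  shows "C_on (Suc k) S f"
proof -
  have "frechet_derivative f (at x) = f' x" if "x \<in> S" for x
    using assms(2) frechet_derivative_at that by metis
  then have "C_on k S (\<lambda>x. frechet_derivative f (at x) v)" for v
    by (intro C_on_cong[OF assms(1) assms(3)[of v]]) simp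
  then show ?thesis using assms(2) by (auto intro: differentiableI)
qed

lemma C_on_SucE:
  assumes "C_on (Suc k) S f"
  obtains f' where "\<And>x. x \<in> S \<Longrightarrow> (f has_derivative f' x) (at x)"
    and "\<And>v. C_on k S (\<lambda>x. f' x v)"
  using assms that[of "\<lambda>x. frechet_derivative f (at x)"] by (simp add: frechet_derivative_works)

lemma C_on_local:
  assumes "open S" "\<And>x. x \<in> S \<Longrightarrow> \<exists>T. open T \<and> x \<in> T \<and> C_on k T f"
  shows "C_on k S f"
  using assms(2)
proof (induction k arbitrary: f)
  case 0
  then show ?case
    by (auto intro!: continuous_at_imp_continuous_on) (metis continuous_on_eq_continuous_at)
next
  case (Suc k)
  have "f differentiable (at x)" if "x \<in> S" for x using Suc.prems[OF that] by auto
  moreover have "C_on k S (\<lambda>x. frechet_derivative f (at x) v)" for v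
    by (rule Suc.IH) (use Suc.prems in fastforce)
  ultimately show ?case by simp
qed

lemma C_on_const: "open S \<Longrightarrow> C_on k S (\<lambda>_. c)"
proof (induction k arbitrary: c)
  case (Suc k)
  then show ?case by (intro C_on_SucI[where f' = "\<lambda>_ _. 0"]) auto
qed simp

lemma C_on_linear: "open S \<Longrightarrow> bounded_linear L \<Longrightarrow> C_on k S f \<Longrightarrow> C_on k S (\<lambda>x. L (f x))"
proof (induction k arbitrary: f)
  case 0
  then show ?case by (simp add: linear_continuous_on_compose bounded_linear.linear
      bounded_linear.continuous_on)
next
  case (Suc k)
  obtain f' where f': "\<And>x. x \<in> S \<Longrightarrow> (f has_derivative f' x) (at x)"
    "\<And>v. C_on k S (\<lambda>x. f' x v)" using C_on_SucE[OF Suc.prems(3)] by blast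
  show ?case
    by (rule C_on_SucI[where f' = "\<lambda>x v. L (f' x v)"])
      (use Suc f' in \<open>auto intro: bounded_linear.has_derivative\<close>)
qed

lemma C_on_id: "open S \<Longrightarrow> C_on k S (\<lambda>x. x)"
  by (cases k) (auto intro!: C_on_SucI[where f' = "\<lambda>_ v. v"] C_on_const)

lemma C_on_add: "open S \<Longrightarrow> C_on k S f \<Longrightarrow> C_on k S g \<Longrightarrow> C_on k S (\<lambda>x. f x + g x)"
proof (induction k arbitrary: f g)
  case 0
  then show ?case by (simp add: continuous_on_add)
next
  case (Suc k)
  obtain f' where f': "\<And>x. x \<in> S \<Longrightarrow> (f has_derivative f' x) (at x)"
    "\<And>v. C_on k S (\<lambda>x. f' x v)" using C_on_SucE[OF Suc.prems(2)] by blast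
  obtain g' where g': "\<And>x. x \<in> S \<Longrightarrow> (g has_derivative g' x) (at x)"
    "\<And>v. C_on k S (\<lambda>x. g' x v)" using C_on_SucE[OF Suc.prems(3)] by blast
  show ?case
    by (rule C_on_SucI[where f' = "\<lambda>x v. f' x v + g' x v"])
      (use Suc f' g' in \<open>auto intro: has_derivative_add\<close>)
qed

lemma C_on_sum:
  "finite I \<Longrightarrow> open S \<Longrightarrow> (\<And>i. i \<in> I \<Longrightarrow> C_on k S (f i)) \<Longrightarrow> C_on k S (\<lambda>x. \<Sum>i\<in>I. f i x)"
  by (induction I rule: finite_induct) (auto intro: C_on_add C_on_const)

lemma C_on_mult:
  fixes f g :: "'a::real_normed_vector \<Rightarrow> real"
  shows "open S \<Longrightarrow> C_on k S f \<Longrightarrow> C_on k S g \<Longrightarrow> C_on k S (\<lambda>x. f x * g x)"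
proof (induction k arbitrary: f g)
  case 0
  then show ?case by (simp add: continuous_on_mult)
next
  case (Suc k)
  obtain f' where f': "\<And>x. x \<in> S \<Longrightarrow> (f has_derivative f' x) (at x)"
    "\<And>v. C_on k S (\<lambda>x. f' x v)" using C_on_SucE[OF Suc.prems(2)] by blast
  obtain g' where g': "\<And>x. x \<in> S \<Longrightarrow> (g has_derivative g' x) (at x)"
    "\<And>v. C_on k S (\<lambda>x. g' x v)" using C_on_SucE[OF Suc.prems(3)] by blast
  show ?case
  proof (rule C_on_SucI[where f' = "\<lambda>x v. f x * g' x v + f' x v * g x"])
    show "C_on k S (\<lambda>x. f x * g' x v + f' x v * g x)" for v
      using Suc.prems f'(2) g'(2) by (intro C_on_add Suc.IH) (auto intro: C_on_SucD)
  qed (use Suc.prems f' g' in \<open>auto intro: has_derivative_mult\<close>)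
qed

text \<open>The derivative of 1/f is built from 1/f and f', so the induction hypothesis applies to
  its factors at one order less.\<close>

lemma C_on_inverse:
  fixes f :: "'a::real_normed_vector \<Rightarrow> real"
  assumes "open S" "\<And>x. x \<in> S \<Longrightarrow> f x \<noteq> 0"
  shows "C_on k S f \<Longrightarrow> C_on k S (\<lambda>x. inverse (f x))"
proof (induction k)
  case 0
  then show ?case using assms by (simp add: continuous_on_inverse)
next
  case (Suc k)
  obtain f' where f': "\<And>x. x \<in> S \<Longrightarrow> (f has_derivative f' x) (at x)"
    "\<And>v. C_on k S (\<lambda>x. f' x v)" using C_on_SucE[OF Suc.prems] by blast
  show ?case
  proof (rule C_on_SucI[where f' = "\<lambda>x v. (-1) * (inverse (f x) * f' x v * inverse (f x))"])
    show "C_on k S (\<lambda>x. (-1) * (inverse (f x) * f' x v * inverse (f x)))" for v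
      using Suc.prems f'(2) assms
      by (intro C_on_mult Suc.IH C_on_const) (auto intro: C_on_SucD)
    show "((\<lambda>x. inverse (f x)) has_derivative
        (\<lambda>v. (-1) * (inverse (f x) * f' x v * inverse (f x)))) (at x)" if "x \<in> S" for x
      using Deriv.has_derivative_inverse[OF _ f'(1)[OF that]] assms(2)[OF that] by simp
  qed (use assms in auto)
qed

text \<open>The inner derivative moves the direction in which \<open>g\<close> is differentiated,
  whereas \<open>C_on\<close> speaks of fixed directions. Expanding over \<open>Basis\<close> turns
  the chain rule into a finite sum of products with fixed directions.\<close>

lemma C_on_compose:
  fixes f :: "'a::real_normed_vector \<Rightarrow> 'b::euclidean_space" and g :: "'b \<Rightarrow> real"
  assumes "open S" "f ` S \<subseteq> T"
  shows "C_on k S f \<Longrightarrow> C_on k T g \<Longrightarrow> C_on k S (\<lambda>x. g (f x))"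
proof (induction k arbitrary: g)
  case 0
  then show ?case using assms by (auto intro: continuous_on_compose2)
next
  case (Suc k)
  obtain f' where f': "\<And>x. x \<in> S \<Longrightarrow> (f has_derivative f' x) (at x)"
    "\<And>v. C_on k S (\<lambda>x. f' x v)" using C_on_SucE[OF Suc.prems(1)] by blast
  obtain g' where g': "\<And>x. x \<in> T \<Longrightarrow> (g has_derivative g' x) (at x)"
    "\<And>v. C_on k T (\<lambda>x. g' x v)" using C_on_SucE[OF Suc.prems(2)] by blast
  show ?case
  proof (rule C_on_SucI[where f' = "\<lambda>x v. \<Sum>b\<in>Basis. (f' x v \<bullet> b) * g' (f x) b"])
    show "C_on k S (\<lambda>x. \<Sum>b\<in>Basis. (f' x v \<bullet> b) * g' (f x) b)" for v
      using Suc.prems(1) f'(2) g'(2) assms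
      by (intro C_on_sum C_on_mult C_on_linear[where L = "\<lambda>y. y \<bullet> _"] Suc.IH)
        (auto intro: C_on_SucD bounded_linear_inner_left)
  next
    fix x assume x: "x \<in> S"
    then have g: "(g has_derivative g' (f x)) (at (f x))" using g'(1) assms by blast
    have "(\<Sum>b\<in>Basis. (w \<bullet> b) * g' (f x) b) = g' (f x) w" for w
      using Linear_Algebra.linear_componentwise[OF has_derivative_linear[OF g], of w 1]
      by simp
    then show "((\<lambda>x. g (f x)) has_derivative (\<lambda>v. \<Sum>b\<in>Basis. (f' x v \<bullet> b) * g' (f x) b)) (at x)"
      using diff_chain_at[OF f'(1)[OF x] g] by (simp add: o_def)
  qed fact
qed

lemma smooth_on_frechet_derivative:
  "smooth_on S f \<Longrightarrow> smooth_on S (\<lambda>x. frechet_derivative f (at x) v)"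
  unfolding smooth_on_def by (metis C_on.simps(2))

lemma smooth_on_has_derivative:
  "smooth_on S f \<Longrightarrow> x \<in> S \<Longrightarrow> (f has_derivative frechet_derivative f (at x)) (at x)"
  unfolding smooth_on_def 
  by (metis C_on.simps(2) frechet_derivative_works)

lemma smooth_on_continuous_on: "smooth_on S f \<Longrightarrow> continuous_on S f"
  unfolding smooth_on_def by (metis C_on.simps(1))

subsection \<open>A flat function\<close>

text \<open>The powers of \<open>1/s\<close> make this family closed under differentiation.\<close>

definition flat_exp :: "nat \<Rightarrow> real \<Rightarrow> real" where
  "flat_exp n s = (if s > 0 then exp (- inverse s) * inverse s ^ n else 0)"

lemma flat_exp_tendsto_0: "(flat_exp n \<longlongrightarrow> 0) (at 0)"
proof -
  \<comment> \<open>With t = 1/s this is the decay of t^n / exp t at infinity.\<close>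
  have "((\<lambda>s. inverse s ^ n / exp (inverse s)) \<longlongrightarrow> 0) (at_right (0::real))"
    by (rule filterlim_compose[OF tendsto_power_div_exp_0 filterlim_inverse_at_top_right])
  then have "(flat_exp n \<longlongrightarrow> 0) (at_right 0)"
    by (rule Lim_transform_eventually)
      (auto simp: flat_exp_def exp_minus field_simps eventually_at_right_less
        intro!: eventually_mono[OF eventually_at_right_less])
  moreover have "(flat_exp n \<longlongrightarrow> 0) (at_left 0)"
    by (rule tendsto_eventually) (auto simp: flat_exp_def eventually_at_left_field intro: exI[of _ "-1"])
  ultimately show ?thesis using filterlim_split_at by blast
qed

lemma flat_exp_has_derivative:
  "(flat_exp n has_field_derivative flat_exp (n + 2) s - real n * flat_exp (n + 1) s) (at s)"
proof (cases s "0::real" rule: linorder_cases)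
  case less
  have "((\<lambda>_. 0) has_field_derivative 0) (at s)" by simp
  then have "(flat_exp n has_field_derivative 0) (at s)"
    by (rule has_field_derivative_transform_within_open[where S = "{..<0}"])
      (use less in \<open>auto simp: flat_exp_def\<close>)
  then show ?thesis using less by (simp add: flat_exp_def)
next
  case equal
  \<comment> \<open>At the origin the difference quotient of \<open>flat_exp n\<close> is
    \<open>flat_exp (Suc n)\<close>, whose limit is already known.\<close>
  have "((\<lambda>t. (flat_exp n t - flat_exp n 0) / (t - 0)) \<longlongrightarrow> 0) (at 0)"
    by (rule Lim_transform_eventually[OF flat_exp_tendsto_0[of "Suc n"]])
      (auto simp: flat_exp_def field_simps eventually_at_filter)
  then have "(flat_exp n has_field_derivative 0) (at 0)"
    by (simp add: has_field_derivative_iff)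
  then show ?thesis using equal by (simp add: flat_exp_def)
next
  case greater
  \<comment> \<open>For \<open>n = 0\<close> the truncated exponent \<open>n - 1\<close> does no
    harm because the factor \<open>real n\<close> vanishes.\<close>
  have pow: "real n * inverse s ^ (n - 1) * (inverse s * inverse s) = real n * inverse s ^ (n + 1)"
    by (cases n) auto
  have "((\<lambda>s. exp (- inverse s) * inverse s ^ n) has_field_derivative
      exp (- inverse s) * (inverse s * inverse s) * inverse s ^ n -
      exp (- inverse s) * (real n * inverse s ^ (n - 1) * (inverse s * inverse s))) (at s)"
    using greater by (auto intro!: derivative_eq_intros simp: algebra_simps)
  then have "((\<lambda>s. exp (- inverse s) * inverse s ^ n) has_field_derivative
      flat_exp (n + 2) s - real n * flat_exp (n + 1) s) (at s)"
    unfolding pow using greater by (simp add: flat_exp_def algebra_simps)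
  then show ?thesis
    by (rule has_field_derivative_transform_within_open[where S = "{0<..}"])
      (use greater in \<open>auto simp: flat_exp_def\<close>)
qed

lemma C_on_flat_exp: "C_on k UNIV (flat_exp n)"
proof (induction k arbitrary: n)
  case 0
  then show ?case by (auto intro!: continuous_at_imp_continuous_on DERIV_isCont flat_exp_has_derivative)
next
  case (Suc k)
  have "C_on k UNIV (\<lambda>s. v * (flat_exp (n + 2) s + (- real n) * flat_exp (n + 1) s))" for v
    by (intro C_on_mult C_on_add C_on_const Suc) auto
  then have *: "C_on k UNIV (\<lambda>s. (flat_exp (n + 2) s - real n * flat_exp (n + 1) s) * v)" for v
    by (simp add: algebra_simps)
  show ?case
    by (rule C_on_SucI[OF _ _ *])
      (use flat_exp_has_derivative in \<open>auto simp: has_field_derivative_def\<close>)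
qed

lemma smooth_bump:
  fixes a :: "'a::euclidean_space"
  assumes "r > 0"
  obtains \<psi> :: "'a \<Rightarrow> real" where "\<And>k. C_on k UNIV \<psi>" "\<And>x. \<psi> x \<noteq> 0 \<longleftrightarrow> dist a x < r"
proof
  \<comment> \<open>The argument r^2 - |x - a|^2 is positive exactly on the ball; it is written with
    sums and products so that the closure rules for \<open>C_on\<close> apply.\<close>
  let ?\<psi> = "\<lambda>x. flat_exp 0 (r\<^sup>2 + (- 1) * (\<Sum>b\<in>Basis. ((x + - a) \<bullet> b) * ((x + - a) \<bullet> b)))"
  have coord: "C_on k UNIV (\<lambda>x. (x + - a) \<bullet> b)" for k and b :: 'a
    by (intro C_on_linear[OF open_UNIV bounded_linear_inner_left] C_on_add C_on_id C_on_const open_UNIV)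
  have "C_on k UNIV (\<lambda>x. r\<^sup>2 + (- 1) * (\<Sum>b\<in>Basis. ((x + - a) \<bullet> b) * ((x + - a) \<bullet> b)))" for k
    by (intro C_on_add C_on_mult C_on_const C_on_sum coord open_UNIV finite_Basis)
  then show "C_on k UNIV ?\<psi>" for k
    by (rule C_on_compose[OF open_UNIV subset_UNIV _ C_on_flat_exp])
  show "?\<psi> x \<noteq> 0 \<longleftrightarrow> dist a x < r" for x
  proof -
    have "(\<Sum>b\<in>Basis. ((x + - a) \<bullet> b) * ((x + - a) \<bullet> b)) = (dist a x)\<^sup>2"
    proof -
      have "dist a x = norm (x + - a)" by (simp add: dist_norm norm_minus_commute)
      then show ?thesis by (simp only: power2_norm_eq_inner flip: euclidean_inner)
    qed
    moreover have "(dist a x)\<^sup>2 < r\<^sup>2 \<longleftrightarrow> dist a x < r"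
      using assms by (metis less_eq_real_def power2_less_imp_less power_strict_mono zero_le_dist zero_less_numeral)
    ultimately show ?thesis by (simp add: flat_exp_def)
  qed
qed

subsection \<open>Hadamard's lemma\<close>

text \<open>Each differentiation under the integral releases one factor \<open>t\<close> from the
  inner affine map. Carrying the weight \<open>t ^ j\<close> for arbitrary \<open>j\<close> makes
  the family of such integrals closed under differentiation.\<close>

lemma hadamard_integral_derivative:
  fixes f :: "'a::euclidean_space \<Rightarrow> real"
  assumes f: "smooth_on (ball a r) f" and x: "x \<in> ball a r"
  shows "((\<lambda>x. integral (cbox 0 1) (\<lambda>t. t ^ j * f (a + t *\<^sub>R (x - a)))) has_derivative
    (\<lambda>v. integral (cbox 0 1)
      (\<lambda>t. t ^ Suc j * frechet_derivative f (at (a + t *\<^sub>R (x - a))) v))) (at x)"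
proof -
  let ?D = "\<lambda>y. frechet_derivative f (at y)"
  let ?g = "\<lambda>x t. a + t *\<^sub>R (x - a)"
  \<comment> \<open>\<open>leibniz_rule\<close> asks for the derivative of the integrand as a
    continuous map into bounded linear operators; in finite dimension this continuity is checked on
    basis vectors.\<close>
  let ?B = "\<lambda>x t. Blinfun (\<lambda>v. t ^ Suc j * ?D (?g x t) v)"
  have seg: "?g x t \<in> ball a r" if "x \<in> ball a r" "t \<in> cbox 0 1" for x and t :: real
  proof -
    have "\<bar>t\<bar> * norm (x - a) \<le> 1 * norm (x - a)"
      using that(2) by (intro mult_right_mono) auto
    then show ?thesis using that(1) by (simp add: dist_norm norm_minus_commute)
  qed
  have bl: "bounded_linear (\<lambda>v. t ^ Suc j * ?D (?g x t) v)"
    if "x \<in> ball a r" "t \<in> cbox 0 1" for x t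
    using smooth_on_has_derivative[OF f seg[OF that]] has_derivative_bounded_linear
    by (intro bounded_linear_const_mult) blast
  note Bl = bounded_linear_Blinfun_apply[OF bl]
  have cont: "continuous_on (ball a r \<times> cbox 0 1) (\<lambda>z. ?D (?g (fst z) (snd z)) v)" for v
    by (rule continuous_on_compose2[OF smooth_on_continuous_on[OF smooth_on_frechet_derivative[OF f]]])
      (auto intro!: continuous_intros seg simp del: mem_ball)
  have contB: "continuous_on (ball a r \<times> cbox 0 1) (\<lambda>(x, t). ?B x t)"
  proof (rule continuous_on_blinfun_componentwise)
    fix i :: 'a
    have "continuous_on (ball a r \<times> cbox 0 1) (\<lambda>z. snd z ^ Suc j * ?D (?g (fst z) (snd z)) i)"
      by (intro continuous_intros cont)
    then show "continuous_on (ball a r \<times> cbox 0 1)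
        (\<lambda>z. blinfun_apply (case z of (x, t) \<Rightarrow> ?B x t) i)"
      by (rule continuous_on_eq) (auto simp: Bl simp del: mem_ball power_Suc)
  qed
  have "((\<lambda>x. integral (cbox 0 1) (\<lambda>t. t ^ j * f (?g x t))) has_derivative
      integral (cbox 0 1) (?B x)) (at x within ball a r)"
  proof (rule leibniz_rule[OF _ _ contB x convex_ball])
    fix y t assume yt: "y \<in> ball a r" "t \<in> cbox (0::real) 1"
    have g: "((\<lambda>y. ?g y t) has_derivative (\<lambda>v. t *\<^sub>R v)) (at y within ball a r)"
      by (auto intro!: derivative_eq_intros)
    have "((\<lambda>y. f (?g y t)) has_derivative (\<lambda>v. ?D (?g y t) (t *\<^sub>R v))) (at y within ball a r)"
      using has_derivative_compose[OF g smooth_on_has_derivative[OF f seg[OF yt]]] .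
    then have "((\<lambda>y. t ^ j * f (?g y t)) has_derivative (\<lambda>v. t ^ j * ?D (?g y t) (t *\<^sub>R v)))
        (at y within ball a r)"
      by (intro has_derivative_mult_right)
    moreover have "?D (?g y t) (t *\<^sub>R v) = t * ?D (?g y t) v" for v
      using linear_scale[OF has_derivative_linear[OF smooth_on_has_derivative[OF f seg[OF yt]]]]
      by simp
    ultimately show "((\<lambda>y. t ^ j * f (?g y t)) has_derivative blinfun_apply (?B y t))
        (at y within ball a r)"
      unfolding Bl[OF yt] by (simp add: mult_ac)
  next
    fix y assume y: "y \<in> ball a r"
    show "(\<lambda>t. t ^ j * f (?g y t)) integrable_on cbox 0 1"
      by (intro integrable_continuous continuous_intros
          continuous_on_compose2[OF smooth_on_continuous_on[OF f]])
        (auto intro!: seg[OF y] simp del: mem_ball)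
  qed
  moreover have "blinfun_apply (integral (cbox 0 1) (?B x)) v =
      integral (cbox 0 1) (\<lambda>t. t ^ Suc j * ?D (?g x t) v)" for v
  proof -
    have "continuous_on (cbox 0 1) (\<lambda>t. case (x, t) of (x, t) \<Rightarrow> ?B x t)"
      by (rule continuous_on_compose2[OF contB]) (use x in \<open>auto intro!: continuous_intros\<close>)
    then have "continuous_on (cbox 0 1) (?B x)" by (simp only: prod.case)
    then have "blinfun_apply (integral (cbox 0 1) (?B x)) v =
        integral (cbox 0 1) (\<lambda>t. blinfun_apply (?B x t) v)"
      by (intro blinfun_apply_integral integrable_continuous)
    also have "\<dots> = integral (cbox 0 1) (\<lambda>t. t ^ Suc j * ?D (?g x t) v)"
      by (rule Henstock_Kurzweil_Integration.integral_cong) (simp add: Bl[OF x] del: power_Suc)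
    finally show ?thesis .
  qed
  ultimately have "((\<lambda>x. integral (cbox 0 1) (\<lambda>t. t ^ j * f (?g x t))) has_derivative
      (\<lambda>v. integral (cbox 0 1) (\<lambda>t. t ^ Suc j * ?D (?g x t) v))) (at x within ball a r)"
    by (metis (no_types, lifting) ext)
  then show ?thesis using x by (simp add: at_within_open[OF x open_ball])
qed

lemma C_on_hadamard_integral:
  fixes f :: "'a::euclidean_space \<Rightarrow> real"
  shows "smooth_on (ball a r) f \<Longrightarrow>
    C_on k (ball a r) (\<lambda>x. integral (cbox 0 1) (\<lambda>t. t ^ j * f (a + t *\<^sub>R (x - a))))"
proof (induction k arbitrary: f j)
  case 0
  then show ?case using hadamard_integral_derivative[OF 0]
    by (auto intro!: continuous_at_imp_continuous_on has_derivative_continuous)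
next
  case (Suc k)
  show ?case
    by (rule C_on_SucI[OF open_ball hadamard_integral_derivative[OF Suc.prems]
        Suc.IH[OF smooth_on_frechet_derivative[OF Suc.prems]]])
qed

text \<open>The difference f(x) - f(a) is the integral of the derivative along the segment from a to
  x. Expanding the direction x - a in the basis leaves \<open>G b\<close> as the mean of a partial
  derivative over that segment.\<close>

lemma hadamard:
  fixes f :: "'a::euclidean_space \<Rightarrow> real"
  assumes f: "smooth_on (ball a r) f"
  obtains G where "\<And>b. smooth_on (ball a r) (G b)"
    and "\<And>b. G b a = frechet_derivative f (at a) b"
    and "\<And>x. x \<in> ball a r \<Longrightarrow> f x = f a + (\<Sum>b\<in>Basis. ((x - a) \<bullet> b) * G b x)"
proof
  let ?D = "\<lambda>y. frechet_derivative f (at y)"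
  \<comment> \<open>The factor \<open>t ^ 0\<close> is kept so that
    \<open>C_on_hadamard_integral\<close> applies with exponent 0.\<close>
  let ?G = "\<lambda>b x. integral (cbox (0::real) 1) (\<lambda>t. t ^ 0 * ?D (a + t *\<^sub>R (x - a)) b)"
  show "smooth_on (ball a r) (?G b)" for b
    unfolding smooth_on_def
    using C_on_hadamard_integral[OF smooth_on_frechet_derivative[OF f]] by blast
  show "?G b a = ?D a b" for b by simp
  fix x assume x: "x \<in> ball a r"
  have seg: "a + t *\<^sub>R (x - a) \<in> ball a r" if "t \<in> {0..1}" for t :: real
  proof -
    have "\<bar>t\<bar> * norm (x - a) \<le> 1 * norm (x - a)"
      using that by (intro mult_right_mono) auto
    then show ?thesis using x by (simp add: dist_norm norm_minus_commute)
  qed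
  have "((\<lambda>t. ?D (a + t *\<^sub>R (x - a)) (x - a)) has_integral
      f (a + 1 *\<^sub>R (x - a)) - f (a + 0 *\<^sub>R (x - a))) {0..1}"
  proof (rule fundamental_theorem_of_calculus)
    fix t :: real assume t: "t \<in> {0..1}"
    note d = smooth_on_has_derivative[OF f seg[OF t]]
    have g: "((\<lambda>t. a + t *\<^sub>R (x - a)) has_derivative (\<lambda>s. s *\<^sub>R (x - a))) (at t within {0..1})"
      by (auto intro!: derivative_eq_intros)
    show "((\<lambda>t. f (a + t *\<^sub>R (x - a))) has_vector_derivative ?D (a + t *\<^sub>R (x - a)) (x - a))
        (at t within {0..1})"
      using has_derivative_compose[OF g d] linear_scale[OF has_derivative_linear[OF d]]
      by (simp add: has_vector_derivative_def)
  qed simp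
  then have "f x - f a = integral {0..1} (\<lambda>t. ?D (a + t *\<^sub>R (x - a)) (x - a))"
    by (simp add: integral_unique)
  also have "\<dots> = integral {0..1}
      (\<lambda>t. \<Sum>b\<in>Basis. ((x - a) \<bullet> b) * ?D (a + t *\<^sub>R (x - a)) b)"
  proof (rule Henstock_Kurzweil_Integration.integral_cong)
    fix t :: real assume t: "t \<in> {0..1}"
    show "?D (a + t *\<^sub>R (x - a)) (x - a) =
        (\<Sum>b\<in>Basis. ((x - a) \<bullet> b) * ?D (a + t *\<^sub>R (x - a)) b)"
      using Linear_Algebra.linear_componentwise[OF has_derivative_linear[OF
          smooth_on_has_derivative[OF f seg[OF t]]], of "x - a" 1] by simp
  qed
  also have "\<dots> = (\<Sum>b\<in>Basis. ((x - a) \<bullet> b) * ?G b x)"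
  proof -
    have "(\<lambda>t. ?D (a + t *\<^sub>R (x - a)) b) integrable_on {0..1}" for b
      by (intro integrable_continuous_real continuous_intros
          continuous_on_compose2[OF smooth_on_continuous_on[OF smooth_on_frechet_derivative[OF f]]])
        (auto intro!: seg simp del: mem_ball)
    then show ?thesis
      by (subst integral_sum) (auto intro: integrable_on_mult_right)
  qed
  finally show "f x = f a + (\<Sum>b\<in>Basis. ((x - a) \<bullet> b) * ?G b x)" by simp
qed

section \<open>Smooth functions on a manifold\<close>

lemma sum_fun_apply: "(\<Sum>i\<in>I. f i) x = (\<Sum>i\<in>I. f i x)"
  for f :: "'i \<Rightarrow> 'x \<Rightarrow> 'y::comm_monoid_add"
  by (induction I rule: infinite_finite_induct) auto

lemma scale_apply [simp]: "scale c u x = c * u x"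
  by (simp add: scale_def)

lemma smul_apply: "smul f s p = scale (f p) (s p)"
  by (simp add: smul_def)

text \<open>One neighbourhood serves all charts and all orders, so the condition is open in
  \<open>p\<close>. Global smoothness becomes a statement about each point separately, and gluing or
  cutting off becomes a case distinction on the point.\<close>

definition smooth_at ::
  "('m::topological_space, 'e::euclidean_space) chart set \<Rightarrow> 'm \<Rightarrow> ('m \<Rightarrow> real) \<Rightarrow> bool" where
  "smooth_at A p f \<longleftrightarrow> (\<exists>W. open W \<and> p \<in> W \<and>
     (\<forall>(U, \<phi>)\<in>A. \<forall>k. C_on k (\<phi> ` (U \<inter> W)) (\<lambda>y. f (inv_into U \<phi> y))))"

locale smooth_manifold =
  fixes A :: "('m::{t2_space, second_countable_topology}, 'e::euclidean_space) chart set"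
  assumes atlas: "smooth_atlas A"
begin

section \<open>Charts and their transition maps\<close>

lemma chart_at:
  obtains U \<phi> where "(U, \<phi>) \<in> A" "p \<in> U"
proof -
  have "p \<in> (\<Union>(U, \<phi>)\<in>A. U)" using atlas by (simp add: smooth_atlas_def)
  then show thesis using that by blast
qed

context
  fixes U \<phi> assumes chart: "(U, \<phi>) \<in> A"
begin

lemma chart_open: "open U"
  using atlas chart unfolding smooth_atlas_def by fast

lemma chart_homeomorphism: "homeomorphism U (\<phi> ` U) \<phi> (inv_into U \<phi>)"
  using atlas chart unfolding smooth_atlas_def by fast

lemma chart_inv [simp]: "q \<in> U \<Longrightarrow> inv_into U \<phi> (\<phi> q) = q"
  using chart_homeomorphism by (simp add: homeomorphism_def)

lemma chart_continuous: "continuous_on U \<phi>"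
  using chart_homeomorphism by (simp add: homeomorphism_def)

lemma chart_open_image:
  assumes "open W"
  shows "open (\<phi> ` (U \<inter> W))"
proof -
  have "openin (top_of_set (\<phi> ` U)) (\<phi> ` (U \<inter> W))"
    using homeomorphism_imp_open_map[OF chart_homeomorphism] assms by (simp add: openin_open_Int)
  moreover have "open (\<phi> ` U)"
    using atlas chart unfolding smooth_atlas_def by fast
  ultimately show ?thesis by (simp add: openin_open_eq)
qed

lemma chart_transition:
  assumes "(V, \<psi>) \<in> A"
  shows "C_on k (\<phi> ` (U \<inter> V)) (\<lambda>y. \<psi> (inv_into U \<phi> y))"
proof -
  have "smooth_on (\<phi> ` (U \<inter> V)) (\<psi> \<circ> inv_into U \<phi>)"
    using atlas chart assms unfolding smooth_atlas_def by fast
  then show ?thesis by (simp add: smooth_on_def o_def)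
qed

end

lemma smooth_atE:
  assumes "smooth_at A p f"
  obtains W where "open W" "p \<in> W"
    and "\<And>U \<phi> k. (U, \<phi>) \<in> A \<Longrightarrow> C_on k (\<phi> ` (U \<inter> W)) (\<lambda>y. f (inv_into U \<phi> y))"
  using assms unfolding smooth_at_def by blast

lemma smooth_atI:
  assumes "open W" "p \<in> W"
    and "\<And>U \<phi> k. (U, \<phi>) \<in> A \<Longrightarrow> C_on k (\<phi> ` (U \<inter> W)) (\<lambda>y. f (inv_into U \<phi> y))"
  shows "smooth_at A p f"
  using assms unfolding smooth_at_def by blast

lemma smooth_at_nhd:
  assumes "smooth_at A p f"
  obtains W where "open W" "p \<in> W" "\<And>q. q \<in> W \<Longrightarrow> smooth_at A q f"
  using assms by (meson smooth_atE smooth_atI)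

lemma smooth_functions_iff: "f \<in> smooth_functions A \<longleftrightarrow> (\<forall>p. smooth_at A p f)"
proof
  assume f: "f \<in> smooth_functions A"
  show "\<forall>p. smooth_at A p f"
    by (intro allI smooth_atI[where W = UNIV])
      (use f in \<open>auto simp: smooth_functions_def smooth_on_def o_def\<close>)
next
  assume f: "\<forall>p. smooth_at A p f"
  have "C_on k (\<phi> ` U) (\<lambda>y. f (inv_into U \<phi> y))" if c: "(U, \<phi>) \<in> A" for U \<phi> k
  proof (rule C_on_local)
    show "open (\<phi> ` U)" using chart_open_image[OF c open_UNIV] by simp
    fix y assume "y \<in> \<phi> ` U"
    then obtain q where q: "q \<in> U" "y = \<phi> q" by blast
    have "smooth_at A q f" using f by blast
    then obtain W where "open W" "q \<in> W" "C_on k (\<phi> ` (U \<inter> W)) (\<lambda>y. f (inv_into U \<phi> y))"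
      by (rule smooth_atE) (use c in blast)
    then show "\<exists>T. open T \<and> y \<in> T \<and> C_on k T (\<lambda>y. f (inv_into U \<phi> y))"
      using chart_open_image[OF c] q by (intro exI[of _ "\<phi> ` (U \<inter> W)"]) auto
  qed
  then show "f \<in> smooth_functions A"
    by (auto simp: smooth_functions_def smooth_on_def o_def)
qed

section \<open>Germs of smooth functions: locality and algebra\<close>

lemma smooth_at_cong:
  assumes "smooth_at A p f" "open N" "p \<in> N" "\<And>q. q \<in> N \<Longrightarrow> f q = g q"
  shows "smooth_at A p g"
proof -
  obtain W where W: "open W" "p \<in> W"
    "\<And>U \<phi> k. (U, \<phi>) \<in> A \<Longrightarrow> C_on k (\<phi> ` (U \<inter> W)) (\<lambda>y. f (inv_into U \<phi> y))"
    using assms(1) by (rule smooth_atE) blast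
  show ?thesis
  proof (rule smooth_atI[of "W \<inter> N"])
    fix U \<phi> k assume c: "(U, \<phi>) \<in> A"
    have "C_on k (\<phi> ` (U \<inter> (W \<inter> N))) (\<lambda>y. f (inv_into U \<phi> y))"
      by (rule C_on_subset[OF W(3)[OF c]]) auto
    then show "C_on k (\<phi> ` (U \<inter> (W \<inter> N))) (\<lambda>y. g (inv_into U \<phi> y))"
      by (rule C_on_cong[OF chart_open_image[OF c], rotated])
        (use assms W c in auto)
  qed (use W assms in auto)
qed

lemma smooth_at_const: "smooth_at A p (\<lambda>_. c)"
  by (rule smooth_atI[of UNIV]) (use chart_open_image[OF _ open_UNIV] in \<open>auto intro!: C_on_const\<close>)

lemma smooth_at_add:
  assumes "smooth_at A p f" "smooth_at A p g"
  shows "smooth_at A p (\<lambda>q. f q + g q)"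
proof -
  obtain W where W: "open W" "p \<in> W"
    "\<And>U \<phi> k. (U, \<phi>) \<in> A \<Longrightarrow> C_on k (\<phi> ` (U \<inter> W)) (\<lambda>y. f (inv_into U \<phi> y))"
    using assms(1) by (rule smooth_atE) blast
  obtain V where V: "open V" "p \<in> V"
    "\<And>U \<phi> k. (U, \<phi>) \<in> A \<Longrightarrow> C_on k (\<phi> ` (U \<inter> V)) (\<lambda>y. g (inv_into U \<phi> y))"
    using assms(2) by (rule smooth_atE) blast
  show ?thesis
    by (rule smooth_atI[of "W \<inter> V"])
      (use W V in \<open>auto intro!: C_on_add chart_open_image intro: C_on_subset[OF W(3)] C_on_subset[OF V(3)]\<close>)
qed

lemma smooth_at_mult:
  assumes "smooth_at A p f" "smooth_at A p g"
  shows "smooth_at A p (\<lambda>q. f q * g q)"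
proof -
  obtain W where W: "open W" "p \<in> W"
    "\<And>U \<phi> k. (U, \<phi>) \<in> A \<Longrightarrow> C_on k (\<phi> ` (U \<inter> W)) (\<lambda>y. f (inv_into U \<phi> y))"
    using assms(1) by (rule smooth_atE) blast
  obtain V where V: "open V" "p \<in> V"
    "\<And>U \<phi> k. (U, \<phi>) \<in> A \<Longrightarrow> C_on k (\<phi> ` (U \<inter> V)) (\<lambda>y. g (inv_into U \<phi> y))"
    using assms(2) by (rule smooth_atE) blast
  show ?thesis
    by (rule smooth_atI[of "W \<inter> V"])
      (use W V in \<open>auto intro!: C_on_mult chart_open_image intro: C_on_subset[OF W(3)] C_on_subset[OF V(3)]\<close>)
qed

lemma smooth_at_minus: "smooth_at A p f \<Longrightarrow> smooth_at A p g \<Longrightarrow> smooth_at A p (\<lambda>q. f q - g q)"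
  using smooth_at_add[of p f "\<lambda>q. (-1) * g q"] smooth_at_mult[OF smooth_at_const[of p "-1"], of g]
  by simp

lemma smooth_at_sum:
  "finite I \<Longrightarrow> (\<And>i. i \<in> I \<Longrightarrow> smooth_at A p (f i)) \<Longrightarrow> smooth_at A p (\<lambda>q. \<Sum>i\<in>I. f i q)"
  by (induction I rule: finite_induct) (auto intro: smooth_at_add smooth_at_const)

lemma smooth_at_isCont:
  assumes "smooth_at A p f"
  shows "isCont f p"
proof -
  obtain W where W: "open W" "p \<in> W"
    "\<And>U \<phi> k. (U, \<phi>) \<in> A \<Longrightarrow> C_on k (\<phi> ` (U \<inter> W)) (\<lambda>y. f (inv_into U \<phi> y))"
    using assms by (rule smooth_atE) blast
  obtain U \<phi> where c: "(U, \<phi>) \<in> A" "p \<in> U" by (rule chart_at)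
  have "continuous_on (\<phi> ` (U \<inter> W)) (\<lambda>y. f (inv_into U \<phi> y))"
    using W(3)[OF c(1), of 0] by simp
  then have "continuous_on (U \<inter> W) (\<lambda>q. f (inv_into U \<phi> (\<phi> q)))"
    by (rule continuous_on_compose2)
      (use chart_continuous[OF c(1)] in \<open>auto intro: continuous_on_subset\<close>)
  then have "continuous_on (U \<inter> W) f"
    by (rule continuous_on_eq) (simp add: c)
  moreover have "open (U \<inter> W)" using chart_open[OF c(1)] W by blast
  ultimately show ?thesis
    using c W by (simp add: continuous_on_eq_continuous_at)
qed

lemma smooth_at_nonzero_nhd:
  assumes "smooth_at A p f" "f p \<noteq> 0"
  obtains N where "open N" "p \<in> N" "\<And>q. q \<in> N \<Longrightarrow> f q \<noteq> 0"
proof -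
  have "f \<midarrow>p\<rightarrow> f p" using smooth_at_isCont[OF assms(1)] by (simp add: isCont_def)
  then have "eventually (\<lambda>q. f q \<noteq> 0) (at p)" using assms(2) tendsto_imp_eventually_ne by blast
  then obtain N where "open N" "p \<in> N" "\<forall>q\<in>N. q \<noteq> p \<longrightarrow> f q \<noteq> 0"
    unfolding eventually_at_topological by blast
  then show thesis using that assms(2) by metis
qed

lemma smooth_at_inverse:
  assumes "smooth_at A p f" "f p \<noteq> 0"
  shows "smooth_at A p (\<lambda>q. inverse (f q))"
proof -
  obtain W where W: "open W" "p \<in> W"
    "\<And>U \<phi> k. (U, \<phi>) \<in> A \<Longrightarrow> C_on k (\<phi> ` (U \<inter> W)) (\<lambda>y. f (inv_into U \<phi> y))"
    using assms(1) by (rule smooth_atE) blast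
  obtain N where N: "open N" "p \<in> N" "\<And>q. q \<in> N \<Longrightarrow> f q \<noteq> 0"
    using smooth_at_nonzero_nhd[OF assms] by blast
  show ?thesis
  proof (rule smooth_atI[of "W \<inter> N"])
    fix U \<phi> k assume c: "(U, \<phi>) \<in> A"
    show "C_on k (\<phi> ` (U \<inter> (W \<inter> N))) (\<lambda>y. inverse (f (inv_into U \<phi> y)))"
      by (rule C_on_inverse[OF chart_open_image[OF c]])
        (use W N c in \<open>auto intro: C_on_subset[OF W(3)[OF c]]\<close>)
  qed (use W N in auto)
qed

lemma smooth_at_divide:
  "smooth_at A p f \<Longrightarrow> smooth_at A p g \<Longrightarrow> g p \<noteq> 0 \<Longrightarrow> smooth_at A p (\<lambda>q. f q / g q)"
  unfolding divide_inverse by (intro smooth_at_mult smooth_at_inverse)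

text \<open>This is where compatibility of the atlas enters: in any other chart the function is
  \<open>g\<close> composed with a transition map.\<close>

lemma smooth_at_chart:
  assumes c: "(U, \<phi>) \<in> A" "p \<in> U" and V: "open V" "\<phi> p \<in> V" "\<And>k. C_on k V g"
  shows "smooth_at A p (\<lambda>q. g (\<phi> q))"
proof (rule smooth_atI[of "U \<inter> \<phi> -` V"])
  show o: "open (U \<inter> \<phi> -` V)"
    using continuous_open_preimage[OF chart_continuous chart_open V(1)] c by blast
  fix U' \<phi>' k assume c': "(U', \<phi>') \<in> A"
  have "C_on k (\<phi>' ` (U' \<inter> (U \<inter> \<phi> -` V))) (\<lambda>y. \<phi> (inv_into U' \<phi>' y))"
    by (rule C_on_subset[OF chart_transition[OF c' c(1)]]) auto
  then show "C_on k (\<phi>' ` (U' \<inter> (U \<inter> \<phi> -` V))) (\<lambda>y. g (\<phi> (inv_into U' \<phi>' y)))"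
    by (rule C_on_compose[rotated 2, OF _ V(3)])
      (use chart_open_image[OF c' o] c' in auto)
qed (use assms in auto)

lemma smooth_functions_add: "f \<in> smooth_functions A \<Longrightarrow> g \<in> smooth_functions A \<Longrightarrow> f + g \<in> smooth_functions A"
  by (simp add: smooth_functions_iff plus_fun_def smooth_at_add)

lemma smooth_functions_mult: "f \<in> smooth_functions A \<Longrightarrow> g \<in> smooth_functions A \<Longrightarrow> f * g \<in> smooth_functions A"
  by (simp add: smooth_functions_iff times_fun_def smooth_at_mult)

lemma smooth_functions_diff: "f \<in> smooth_functions A \<Longrightarrow> g \<in> smooth_functions A \<Longrightarrow> f - g \<in> smooth_functions A"
  by (simp add: smooth_functions_iff fun_diff_def smooth_at_minus)

lemma smooth_functions_const: "(\<lambda>_. c) \<in> smooth_functions A"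
  by (simp add: smooth_functions_iff smooth_at_const)

lemma smooth_functions_scale: "f \<in> smooth_functions A \<Longrightarrow> scale c f \<in> smooth_functions A"
  by (simp add: smooth_functions_iff scale_def smooth_at_mult smooth_at_const)

lemma smooth_functions_sum:
  "(\<And>i. i \<in> I \<Longrightarrow> f i \<in> smooth_functions A) \<Longrightarrow> (\<Sum>i\<in>I. f i) \<in> smooth_functions A"
  by (induction I rule: infinite_finite_induct)
    (auto intro: smooth_functions_add smooth_functions_const simp: zero_fun_def)

text \<open>Vanishing off \<open>W\<close> alone would be too weak. The closed set \<open>K\<close>
  inside \<open>W\<close> leaves an open complement on which the bump is zero, so its product with a
  function smooth only on \<open>W\<close> is smooth across the boundary of
  \<open>W\<close>.\<close>

definition bump_in :: "'m set \<Rightarrow> ('m \<Rightarrow> real) \<Rightarrow> bool" where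
  "bump_in W \<kappa> \<longleftrightarrow> \<kappa> \<in> smooth_functions A \<and> (\<exists>K. closed K \<and> K \<subseteq> W \<and> (\<forall>q. q \<notin> K \<longrightarrow> \<kappa> q = 0))"

lemma bump_in_smooth: "bump_in W \<kappa> \<Longrightarrow> \<kappa> \<in> smooth_functions A"
  by (simp add: bump_in_def)

lemma bump_in_zero: "bump_in W \<kappa> \<Longrightarrow> q \<notin> W \<Longrightarrow> \<kappa> q = 0"
  unfolding bump_in_def by blast

lemma bump_in_mult:
  assumes "bump_in W \<kappa>" "\<And>q. q \<in> W \<Longrightarrow> smooth_at A q f"
  shows "(\<lambda>q. \<kappa> q * f q) \<in> smooth_functions A"
  unfolding smooth_functions_iff
proof
  fix p
  obtain K where K: "closed K" "K \<subseteq> W" "\<And>q. q \<notin> K \<Longrightarrow> \<kappa> q = 0"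
    using assms(1) unfolding bump_in_def by blast
  show "smooth_at A p (\<lambda>q. \<kappa> q * f q)"
  proof (cases "p \<in> K")
    case True
    then show ?thesis
      using assms K by (intro smooth_at_mult) (auto simp: bump_in_def smooth_functions_iff)
  next
    case False
    show ?thesis
      by (rule smooth_at_cong[OF smooth_at_const[of p 0], of "- K"]) (use K False in auto)
  qed
qed

lemma bump_exists:
  assumes "open W" "p \<in> W"
  obtains \<kappa> where "bump_in W \<kappa>" "\<kappa> p \<noteq> 0"
proof -
  obtain U \<phi> where c: "(U, \<phi>) \<in> A" "p \<in> U" by (rule chart_at)
  have "open (\<phi> ` (U \<inter> W))" "\<phi> p \<in> \<phi> ` (U \<inter> W)"
    using chart_open_image[OF c(1)] assms c by auto
  then obtain r where r: "r > 0" "cball (\<phi> p) r \<subseteq> \<phi> ` (U \<inter> W)"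
    using open_contains_cball by metis
  obtain \<psi> :: "'e \<Rightarrow> real" where \<psi>: "\<And>k. C_on k UNIV \<psi>" "\<And>x. \<psi> x \<noteq> 0 \<longleftrightarrow> dist (\<phi> p) x < r"
    using smooth_bump[OF r(1)] by blast
  define \<kappa> where "\<kappa> q = (if q \<in> U then \<psi> (\<phi> q) else 0)" for q
  define K where "K = inv_into U \<phi> ` cball (\<phi> p) r"
  have "continuous_on (\<phi> ` U) (inv_into U \<phi>)"
    using chart_homeomorphism[OF c(1)] by (simp add: homeomorphism_def)
  then have "compact K"
    unfolding K_def using r(2) by (intro compact_continuous_image) (auto intro: continuous_on_subset)
  \<comment> \<open>The Hausdorff axiom is used here: \<open>K\<close> is compact as a continuous
    image of a closed ball, and is therefore closed in the whole manifold, not merely in the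
    chart.\<close>
  then have K: "closed K" by (rule compact_imp_closed)
  have KW: "K \<subseteq> U \<inter> W"
    unfolding K_def using r(2) c(1) by (force simp: subset_iff)
  have zero: "\<kappa> q = 0" if "q \<notin> K" for q
  proof (cases "q \<in> U")
    case True
    then have "\<phi> q \<notin> cball (\<phi> p) r"
      using that c(1) unfolding K_def by (metis chart_inv image_eqI)
    then show ?thesis using \<psi>(2)[of "\<phi> q"] by (auto simp: \<kappa>_def)
  qed (simp add: \<kappa>_def)
  have "smooth_at A q \<kappa>" for q
  proof (cases "q \<in> U")
    case True
    show ?thesis
      by (rule smooth_at_cong[OF smooth_at_chart[OF c(1) True open_UNIV UNIV_I \<psi>(1)]
            chart_open[OF c(1)] True])
        (simp add: \<kappa>_def)
  next
    case False
    show ?thesis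
      by (rule smooth_at_cong[OF smooth_at_const[of q 0], of "- K"])
        (use K KW zero False in auto)
  qed
  then have "bump_in W \<kappa>"
    unfolding bump_in_def smooth_functions_iff using K KW zero by blast
  moreover have "\<kappa> p \<noteq> 0" using \<psi>(2)[of "\<phi> p"] r c by (simp add: \<kappa>_def)
  ultimately show thesis by (rule that)
qed

text \<open>Gaussian elimination on the unknowns \<open>J\<close>, at the level of germs at
  \<open>p\<close>. The trivial kernel at \<open>p\<close> provides a pivot, which stays non-zero
  near \<open>p\<close>; the reduced system inherits every hypothesis. The \<open>x j\<close> are
  arbitrary functions solving the system near \<open>p\<close>, and their smoothness is the
  outcome.\<close>

lemma smooth_at_solution:
  assumes "finite J" "open N" "p \<in> N"
    and "\<And>i j. i \<in> I \<Longrightarrow> j \<in> J \<Longrightarrow> smooth_at A p (a i j)"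
    and "\<And>i. i \<in> I \<Longrightarrow> smooth_at A p (b i)"
    and "\<And>i q. i \<in> I \<Longrightarrow> q \<in> N \<Longrightarrow> (\<Sum>j\<in>J. a i j q * x j q) = b i q"
    and "\<And>y. (\<And>i. i \<in> I \<Longrightarrow> (\<Sum>j\<in>J. a i j p * y j) = 0) \<Longrightarrow> (\<And>j. j \<in> J \<Longrightarrow> y j = 0)"
  shows "\<forall>j\<in>J. smooth_at A p (x j)"
  using assms
proof (induction J arbitrary: N a b rule: finite_induct)
  case (insert j0 J)
  note sa = insert.prems(3) and sb = insert.prems(4) and sol = insert.prems(5)
    and ker = insert.prems(6)
  \<comment> \<open>If column \<open>j0\<close> vanished at \<open>p\<close>, the unit vector at
    \<open>j0\<close> would be a non-zero kernel element.\<close>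
  have "\<exists>i0\<in>I. a i0 j0 p \<noteq> 0"
  proof (rule ccontr)
    assume *: "\<not> (\<exists>i0\<in>I. a i0 j0 p \<noteq> 0)"
    define y where "y j = (if j = j0 then 1 else 0 :: real)" for j
    have "(\<Sum>j\<in>insert j0 J. a i j p * y j) = 0" if "i \<in> I" for i
      using insert.hyps * that by (auto simp: y_def intro!: sum.neutral)
    then have "y j0 = 0" using ker[of y j0] by blast
    then show False by (simp add: y_def)
  qed
  then obtain i0 where i0: "i0 \<in> I" "a i0 j0 p \<noteq> 0" by blast
  obtain N' where N': "open N'" "p \<in> N'" "\<And>q. q \<in> N' \<Longrightarrow> a i0 j0 q \<noteq> 0"
    using smooth_at_nonzero_nhd[OF sa[OF i0(1)] i0(2)] by blast
  define M where "M = N \<inter> N'"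
  have M: "open M" "p \<in> M" "M \<subseteq> N" "\<And>q. q \<in> M \<Longrightarrow> a i0 j0 q \<noteq> 0"
    using N' insert.prems by (auto simp: M_def)
  \<comment> \<open>The multiplier that clears column \<open>j0\<close> from equation
    \<open>i\<close>; equation \<open>i0\<close> itself reduces to 0 = 0 on
    \<open>M\<close>.\<close>
  define r where "r i q = a i j0 q / a i0 j0 q" for i q
  have sr: "smooth_at A p (r i)" if "i \<in> I" for i
    unfolding r_def using sa i0 that by (intro smooth_at_divide) auto
  have x0: "x j0 q = (b i0 q - (\<Sum>j\<in>J. a i0 j q * x j q)) / a i0 j0 q" if "q \<in> M" for q
    using sol[OF i0(1), of q] M that insert.hyps by (auto simp: field_simps)
  have J: "\<forall>j\<in>J. smooth_at A p (x j)"
  proof (rule insert.IH[where a = "\<lambda>i j q. a i j q - r i q * a i0 j q"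
        and b = "\<lambda>i q. b i q - r i q * b i0 q", OF M(1,2)])
    show "smooth_at A p (\<lambda>q. a i j q - r i q * a i0 j q)" if "i \<in> I" "j \<in> J" for i j
      using sa sr i0 that by (intro smooth_at_minus smooth_at_mult) auto
    show "smooth_at A p (\<lambda>q. b i q - r i q * b i0 q)" if "i \<in> I" for i
      using sb sr i0 that by (intro smooth_at_minus smooth_at_mult) auto
    show "(\<Sum>j\<in>J. (a i j q - r i q * a i0 j q) * x j q) = b i q - r i q * b i0 q"
      if i: "i \<in> I" and q: "q \<in> M" for i q
    proof -
      have eq: "a i' j0 q * x j0 q + (\<Sum>j\<in>J. a i' j q * x j q) = b i' q" if "i' \<in> I" for i'
        using sol[OF that, of q] M q insert.hyps by auto
      have "(\<Sum>j\<in>J. (a i j q - r i q * a i0 j q) * x j q) =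
          (\<Sum>j\<in>J. a i j q * x j q) - r i q * (\<Sum>j\<in>J. a i0 j q * x j q)"
        by (simp add: left_diff_distrib sum_subtractf sum_distrib_left mult.assoc)
      also have "\<dots> = (b i q - a i j0 q * x j0 q) - r i q * (b i0 q - a i0 j0 q * x j0 q)"
        unfolding eq[OF i, symmetric] eq[OF i0(1), symmetric] by simp
      also have "\<dots> = b i q - r i q * b i0 q"
        using M(4)[OF q] by (simp add: r_def field_simps)
      finally show ?thesis .
    qed
    show "y j = 0" if y: "\<And>i. i \<in> I \<Longrightarrow> (\<Sum>j\<in>J. (a i j p - r i p * a i0 j p) * y j) = 0"
      and j: "j \<in> J" for y j
    proof -
      \<comment> \<open>A kernel vector of the reduced system is lifted to the full one: its
        \<open>j0\<close> entry is chosen to satisfy equation \<open>i0\<close>.\<close>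
      define z where "z = y(j0 := - (\<Sum>j\<in>J. a i0 j p * y j) / a i0 j0 p)"
      have z: "(\<Sum>j\<in>J. a i j p * z j) = (\<Sum>j\<in>J. a i j p * y j)" for i
        by (rule sum.cong) (use insert.hyps in \<open>auto simp: z_def\<close>)
      have "(\<Sum>j\<in>insert j0 J. a i j p * z j) = 0" if "i \<in> I" for i
      proof -
        have "(\<Sum>j\<in>insert j0 J. a i j p * z j) =
            (\<Sum>j\<in>J. a i j p * y j) - r i p * (\<Sum>j\<in>J. a i0 j p * y j)"
          using insert.hyps z by (simp add: z_def r_def)
        also have "\<dots> = (\<Sum>j\<in>J. (a i j p - r i p * a i0 j p) * y j)"
          by (simp add: left_diff_distrib sum_subtractf sum_distrib_left mult.assoc)
        finally show ?thesis using y[OF that] by simp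
      qed
      then have "z j = 0" using ker[of z j] j by blast
      then show ?thesis using insert.hyps j by (auto simp: z_def split: if_splits)
    qed
  qed
  \<comment> \<open>Back substitution for the eliminated unknown.\<close>
  have "smooth_at A p (\<lambda>q. (b i0 q - (\<Sum>j\<in>J. a i0 j q * x j q)) / a i0 j0 q)"
    using sa sb i0 J insert.hyps
    by (intro smooth_at_divide smooth_at_minus smooth_at_sum smooth_at_mult) auto
  then have "smooth_at A p (x j0)"
    by (rule smooth_at_cong[OF _ M(1,2)]) (simp add: x0)
  then show ?case using J by blast
qed simp

end

section \<open>Tangent vectors and local frames\<close>

context smooth_manifold
begin

section \<open>Tangent vectors as point derivations\<close>

lemma tangent_add: "u \<in> tangent_space A p \<Longrightarrow> v \<in> tangent_space A p \<Longrightarrow> u + v \<in> tangent_space A p"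
  unfolding tangent_space_def by (auto simp: algebra_simps)

lemma tangent_scale: "u \<in> tangent_space A p \<Longrightarrow> scale c u \<in> tangent_space A p"
  unfolding tangent_space_def by (auto simp: algebra_simps)

lemma tangent_zero: "0 \<in> tangent_space A p"
  unfolding tangent_space_def by auto

lemma tangent_sum: "(\<And>i. i \<in> I \<Longrightarrow> u i \<in> tangent_space A p) \<Longrightarrow> (\<Sum>i\<in>I. u i) \<in> tangent_space A p"
  by (induction I rule: infinite_finite_induct) (auto intro: tangent_add tangent_zero)

lemma tangent_outside: "v \<in> tangent_space A p \<Longrightarrow> f \<notin> smooth_functions A \<Longrightarrow> v f = 0"
  unfolding tangent_space_def by auto

context
  fixes v p assumes v: "v \<in> tangent_space A p"
begin

lemma derivation_add:
  "f \<in> smooth_functions A \<Longrightarrow> g \<in> smooth_functions A \<Longrightarrow> v (f + g) = v f + v g"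
  using v unfolding tangent_space_def by auto

lemma derivation_scale: "f \<in> smooth_functions A \<Longrightarrow> v (scale c f) = c * v f"
  using v unfolding tangent_space_def by auto

lemma derivation_mult:
  "f \<in> smooth_functions A \<Longrightarrow> g \<in> smooth_functions A \<Longrightarrow> v (f * g) = f p * v g + g p * v f"
  using v unfolding tangent_space_def by auto

lemma derivation_const: "v (\<lambda>_. c) = 0"
proof -
  have "v ((\<lambda>_. 1) * (\<lambda>_. 1)) = 1 * v (\<lambda>_. 1) + 1 * v (\<lambda>_. 1)"
    using derivation_mult[OF smooth_functions_const smooth_functions_const, of 1 1] by simp
  moreover have "(\<lambda>_. 1) * (\<lambda>_. 1) = (\<lambda>_::'m. 1::real)" by (simp add: times_fun_def)
  ultimately have "v (\<lambda>_. 1) = 0" by simp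
  then show ?thesis
    using derivation_scale[OF smooth_functions_const, of c 1] by (simp add: scale_def)
qed

lemma derivation_zero: "v 0 = 0"
  using derivation_const[of 0] by (simp add: zero_fun_def)

lemma derivation_sum:
  "(\<And>i. i \<in> I \<Longrightarrow> f i \<in> smooth_functions A) \<Longrightarrow> v (\<Sum>i\<in>I. f i) = (\<Sum>i\<in>I. v (f i))"
  by (induction I rule: infinite_finite_induct)
    (auto simp: derivation_add smooth_functions_sum derivation_zero)

end

section \<open>Coordinate derivations and why they exhaust the tangent space\<close>

definition coord_deriv :: "'m set \<Rightarrow> ('m \<Rightarrow> 'e) \<Rightarrow> 'm \<Rightarrow> 'e \<Rightarrow> 'm tvec" where
  "coord_deriv U \<phi> q x = (\<lambda>f. if f \<in> smooth_functions A
     then frechet_derivative (\<lambda>y. f (inv_into U \<phi> y)) (at (\<phi> q)) x else 0)"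

context
  fixes U \<phi> assumes chart: "(U, \<phi>) \<in> A"
begin

lemma chart_smooth_on:
  "f \<in> smooth_functions A \<Longrightarrow> smooth_on (\<phi> ` U) (\<lambda>y. f (inv_into U \<phi> y))"
  using chart unfolding smooth_functions_def o_def by blast

lemma coord_deriv_has_derivative:
  assumes "f \<in> smooth_functions A" "q \<in> U"
  shows "((\<lambda>y. f (inv_into U \<phi> y)) has_derivative (\<lambda>x. coord_deriv U \<phi> q x f)) (at (\<phi> q))"
  using smooth_on_has_derivative[OF chart_smooth_on[OF assms(1)], of "\<phi> q"] assms
  by (simp add: coord_deriv_def)

lemma coord_deriv_eqI:
  assumes "f \<in> smooth_functions A" "q \<in> U"
    and "((\<lambda>y. f (inv_into U \<phi> y)) has_derivative D) (at (\<phi> q))"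
  shows "coord_deriv U \<phi> q x f = D x"
  using has_derivative_unique[OF coord_deriv_has_derivative[OF assms(1,2)] assms(3)] by metis

lemma coord_deriv_tangent:
  assumes q: "q \<in> U"
  shows "coord_deriv U \<phi> q x \<in> tangent_space A q"
  unfolding tangent_space_def
proof (intro CollectI conjI ballI allI impI)
  fix f g assume f: "f \<in> smooth_functions A" and g: "g \<in> smooth_functions A"
  note df = coord_deriv_has_derivative[OF f q] and dg = coord_deriv_has_derivative[OF g q]
  show "coord_deriv U \<phi> q x (f + g) = coord_deriv U \<phi> q x f + coord_deriv U \<phi> q x g"
    using coord_deriv_eqI[OF smooth_functions_add[OF f g] q] has_derivative_add[OF df dg] by simp
  show "coord_deriv U \<phi> q x (f * g) = f q * coord_deriv U \<phi> q x g + g q * coord_deriv U \<phi> q x f"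
    using coord_deriv_eqI[OF smooth_functions_mult[OF f g] q] has_derivative_mult[OF df dg]
      chart_inv[OF chart q] by simp
next
  fix c f assume f: "f \<in> smooth_functions A"
  show "coord_deriv U \<phi> q x (scale c f) = c * coord_deriv U \<phi> q x f"
    by (rule coord_deriv_eqI[OF smooth_functions_scale[OF f] q])
      (use has_derivative_mult_right[OF coord_deriv_has_derivative[OF f q]] in simp)
qed (simp add: coord_deriv_def)

lemma coord_deriv_expand:
  assumes q: "q \<in> U"
  shows "coord_deriv U \<phi> q x f = (\<Sum>b\<in>Basis. (x \<bullet> b) * coord_deriv U \<phi> q b f)"
proof (cases "f \<in> smooth_functions A")
  case True
  then show ?thesis
    using Linear_Algebra.linear_componentwise[OF has_derivative_linear[OF
        coord_deriv_has_derivative[OF True q]], of x 1] by simp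
qed (simp add: coord_deriv_def)

lemma coord_deriv_smooth_at:
  assumes f: "f \<in> smooth_functions A" and q: "q \<in> U"
  shows "smooth_at A q (\<lambda>q. coord_deriv U \<phi> q x f)"
proof -
  have "C_on k (\<phi> ` U) (\<lambda>y. frechet_derivative (\<lambda>y. f (inv_into U \<phi> y)) (at y) x)" for k
    using smooth_on_frechet_derivative[OF chart_smooth_on[OF f]] by (simp add: smooth_on_def)
  moreover have "open (\<phi> ` U)" using chart_open_image[OF chart open_UNIV] by simp
  ultimately have "smooth_at A q (\<lambda>q. frechet_derivative (\<lambda>y. f (inv_into U \<phi> y)) (at (\<phi> q)) x)"
    using q by (intro smooth_at_chart[OF chart q]) auto
  then show ?thesis using f by (simp add: coord_deriv_def)
qed

lemma chart_coordinate_smooth_at: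
  "q \<in> U \<Longrightarrow> smooth_at A q (\<lambda>q'. (\<phi> q' + - a) \<bullet> b)"
  by (rule smooth_at_chart[OF chart _ open_UNIV UNIV_I])
    (assumption | intro C_on_linear[OF open_UNIV bounded_linear_inner_left] C_on_add C_on_id
      C_on_const open_UNIV)+

text \<open>Cut-off coordinate functions centred at \<open>p\<close>; by Hadamard's lemma their differentials at \<open>p\<close>
  span the cotangent space.\<close>

lemma cutoff_coordinates:
  assumes p: "p \<in> U" and \<kappa>: "bump_in U \<kappa>"
  defines "\<xi> \<equiv> \<lambda>b q. \<kappa> q * ((\<phi> q + - \<phi> p) \<bullet> b)"
  shows "\<xi> b \<in> smooth_functions A" "coord_deriv U \<phi> p x (\<xi> b) = \<kappa> p * (x \<bullet> b)"
proof -
  show \<xi>: "\<xi> b \<in> smooth_functions A"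
    unfolding \<xi>_def by (rule bump_in_mult[OF \<kappa>]) (rule chart_coordinate_smooth_at)
  have "((\<lambda>y. (y + - \<phi> p) \<bullet> b) has_derivative (\<lambda>x. x \<bullet> b)) (at (\<phi> p))"
    by (auto intro!: derivative_eq_intros)
  \<comment> \<open>The coordinate factor vanishes at \<open>p\<close>, so the product rule leaves
    no derivative of \<kappa>.\<close>
  then have "((\<lambda>y. \<kappa> (inv_into U \<phi> y) * ((y + - \<phi> p) \<bullet> b)) has_derivative
      (\<lambda>x. \<kappa> p * (x \<bullet> b))) (at (\<phi> p))"
    using has_derivative_mult[OF coord_deriv_has_derivative[OF bump_in_smooth[OF \<kappa>] p]] p
    by (fastforce simp: chart_inv[OF chart])
  then have "((\<lambda>y. \<xi> b (inv_into U \<phi> y)) has_derivative (\<lambda>x. \<kappa> p * (x \<bullet> b))) (at (\<phi> p))"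
  proof (rule has_derivative_transform_within_open)
    show "open (\<phi> ` U)" using chart_open_image[OF chart open_UNIV] by simp
  qed (use p in \<open>auto simp: \<xi>_def chart_inv[OF chart]\<close>)
  then show "coord_deriv U \<phi> p x (\<xi> b) = \<kappa> p * (x \<bullet> b)"
    by (rule coord_deriv_eqI[OF \<xi> p])
qed

text \<open>A derivation at \<open>p\<close> is determined by its values on the cut-off coordinates.
  Hadamard's expansion holds only on a ball in the chart while \<open>v\<close> accepts only global
  functions, so the expansion is multiplied by \<kappa> twice before \<open>v\<close> is applied,
  and the Leibniz rule removes the factors again.\<close>

lemma coord_deriv_span:
  assumes p: "p \<in> U" and v: "v \<in> tangent_space A p"
  obtains x where "v = coord_deriv U \<phi> p x"
proof -
  have "open (\<phi> ` U)" using chart_open_image[OF chart open_UNIV] by simp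
  then obtain r where r: "r > 0" "ball (\<phi> p) r \<subseteq> \<phi> ` U"
    using p open_contains_ball by (metis imageI)
  define W where "W = U \<inter> \<phi> -` ball (\<phi> p) r"
  have W: "open W" "p \<in> W" "W \<subseteq> U"
    using continuous_open_preimage[OF chart_continuous[OF chart] chart_open[OF chart] open_ball] p r
    by (auto simp: W_def)
  obtain \<kappa> where \<kappa>: "bump_in W \<kappa>" "\<kappa> p \<noteq> 0" using bump_exists[OF W(1,2)] by blast
  have \<kappa>U: "bump_in U \<kappa>" using \<kappa>(1) W(3) unfolding bump_in_def by blast
  define \<xi> where "\<xi> b q = \<kappa> q * ((\<phi> q + - \<phi> p) \<bullet> b)" for b q
  have \<xi>: "\<xi> b \<in> smooth_functions A" for b
    using cutoff_coordinates(1)[OF p \<kappa>U] by (simp add: \<xi>_def[abs_def])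
  \<comment> \<open>Forced by \<open>cutoff_coordinates\<close>: the coordinate derivation along
    \<open>x\<close> takes the value \<kappa> p * (x \<bullet> b) on \<open>\<xi> b\<close>.\<close>
  define x where "x = (\<Sum>b\<in>Basis. (v (\<xi> b) / \<kappa> p) *\<^sub>R b)"
  have "v f = coord_deriv U \<phi> p x f" if f: "f \<in> smooth_functions A" for f
  proof -
    let ?F = "\<lambda>y. f (inv_into U \<phi> y)"
    have "smooth_on (ball (\<phi> p) r) ?F"
      using chart_smooth_on[OF f] r(2) C_on_subset unfolding smooth_on_def by blast
    then obtain G where G: "\<And>b. smooth_on (ball (\<phi> p) r) (G b)"
      "\<And>b. G b (\<phi> p) = frechet_derivative ?F (at (\<phi> p)) b"
      "\<And>y. y \<in> ball (\<phi> p) r \<Longrightarrow> ?F y = ?F (\<phi> p) + (\<Sum>b\<in>Basis. ((y - \<phi> p) \<bullet> b) * G b y)"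
      using hadamard by blast
    define \<gamma> where "\<gamma> b q = \<kappa> q * G b (\<phi> q)" for b q
    have \<gamma>: "\<gamma> b \<in> smooth_functions A" for b
      unfolding \<gamma>_def[abs_def]
    proof (rule bump_in_mult[OF \<kappa>(1)])
      fix q assume "q \<in> W"
      then show "smooth_at A q (\<lambda>q. G b (\<phi> q))"
        using G(1) by (intro smooth_at_chart[OF chart, of q "ball (\<phi> p) r"])
          (auto simp: W_def smooth_on_def)
    qed
    have \<kappa>s: "\<kappa> \<in> smooth_functions A" using bump_in_smooth[OF \<kappa>(1)] .
    \<comment> \<open>Subtracting the value at \<open>p\<close> does not change the derivation, and
      because \<open>g p = 0\<close> the derivative of \<kappa> * \<kappa> drops out of the Leibniz
      rule.\<close>
    define g where "g = f - (\<lambda>_. f p)"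
    have g: "g \<in> smooth_functions A" "g p = 0"
      using smooth_functions_diff[OF f smooth_functions_const] by (auto simp: g_def)
    \<comment> \<open>One factor \<kappa> makes the coordinate global, the other makes the Hadamard
      coefficient global. Off \<open>W\<close> both sides are zero.\<close>
    have "\<kappa> * \<kappa> * g = (\<Sum>b\<in>Basis. \<xi> b * \<gamma> b)"
    proof
      fix q
      show "(\<kappa> * \<kappa> * g) q = (\<Sum>b\<in>Basis. \<xi> b * \<gamma> b) q"
      proof (cases "q \<in> W")
        case True
        then have "g q = (\<Sum>b\<in>Basis. ((\<phi> q - \<phi> p) \<bullet> b) * G b (\<phi> q))"
          using G(3)[of "\<phi> q"] p by (simp add: W_def g_def chart_inv[OF chart])
        then show ?thesis
          by (simp add: sum_fun_apply \<xi>_def \<gamma>_def sum_distrib_left algebra_simps)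
      next
        case False
        then show ?thesis
          using bump_in_zero[OF \<kappa>(1)] by (simp add: sum_fun_apply \<xi>_def)
      qed
    qed
    then have "v (\<kappa> * \<kappa> * g) = (\<Sum>b\<in>Basis. v (\<xi> b * \<gamma> b))"
      using derivation_sum[OF v, of Basis "\<lambda>b. \<xi> b * \<gamma> b"] smooth_functions_mult[OF \<xi> \<gamma>] by simp
    also have "\<dots> = (\<Sum>b\<in>Basis. \<kappa> p * G b (\<phi> p) * v (\<xi> b))"
      by (rule sum.cong) (auto simp: derivation_mult[OF v \<xi> \<gamma>], simp add: \<xi>_def \<gamma>_def)
    also have "v (\<kappa> * \<kappa> * g) = \<kappa> p * \<kappa> p * v g"
      using derivation_mult[OF v smooth_functions_mult[OF \<kappa>s \<kappa>s] g(1)] g(2) by simp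
    finally have "\<kappa> p * (\<kappa> p * v g) = \<kappa> p * (\<Sum>b\<in>Basis. G b (\<phi> p) * v (\<xi> b))"
      by (simp add: sum_distrib_left mult.assoc)
    then have "v g = (\<Sum>b\<in>Basis. G b (\<phi> p) * v (\<xi> b)) / \<kappa> p"
      using \<kappa>(2) by (simp add: field_simps)
    then have 1: "v g = (\<Sum>b\<in>Basis. (v (\<xi> b) / \<kappa> p) * G b (\<phi> p))"
      by (simp add: sum_divide_distrib mult.commute)
    have "v f = v (g + (\<lambda>_. f p))" by (simp add: g_def)
    also have "\<dots> = v g"
      using derivation_add[OF v g(1) smooth_functions_const] derivation_const[OF v] by simp
    finally have "v f = (\<Sum>b\<in>Basis. (v (\<xi> b) / \<kappa> p) * coord_deriv U \<phi> p b f)"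
      using 1 f by (simp add: coord_deriv_def G(2))
    also have "\<dots> = coord_deriv U \<phi> p x f"
      unfolding coord_deriv_expand[OF p, of x f] by (rule sum.cong) (simp_all add: x_def)
    finally show ?thesis .
  qed
  moreover have "v f = coord_deriv U \<phi> p x f" if "f \<notin> smooth_functions A" for f
    using tangent_outside[OF v that] that by (simp add: coord_deriv_def)
  ultimately show thesis using that by blast
qed

lemma coord_field_vector_field:
  assumes "bump_in U \<kappa>"
  shows "(\<lambda>q. scale (\<kappa> q) (if q \<in> U then coord_deriv U \<phi> q x else 0)) \<in> vector_fields A"
  unfolding vector_fields_def
proof (intro CollectI conjI allI ballI)
  show "scale (\<kappa> q) (if q \<in> U then coord_deriv U \<phi> q x else 0) \<in> tangent_space A q" for q
    by (auto intro: tangent_scale coord_deriv_tangent tangent_zero)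
  fix f assume f: "f \<in> smooth_functions A"
  have "(\<lambda>q. \<kappa> q * (if q \<in> U then coord_deriv U \<phi> q x f else 0)) \<in> smooth_functions A"
  proof (rule bump_in_mult[OF assms])
    fix q assume q: "q \<in> U"
    show "smooth_at A q (\<lambda>q. if q \<in> U then coord_deriv U \<phi> q x f else 0)"
      by (rule smooth_at_cong[OF coord_deriv_smooth_at[OF f q] chart_open[OF chart] q]) simp
  qed
  moreover have "act (\<lambda>q. scale (\<kappa> q) (if q \<in> U then coord_deriv U \<phi> q x else 0)) f =
      (\<lambda>q. \<kappa> q * (if q \<in> U then coord_deriv U \<phi> q x f else 0))"
    by (auto simp: act_def)
  ultimately show "act (\<lambda>q. scale (\<kappa> q) (if q \<in> U then coord_deriv U \<phi> q x else 0)) f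
      \<in> smooth_functions A" by simp
qed

end

text \<open>The functions \<open>\<xi>\<close> are dual to the frame at \<open>p\<close> up to a factor; they witness its linear
  independence and recover smooth coefficients.\<close>

definition local_frame ::
  "'m \<Rightarrow> 'm set \<Rightarrow> ('e \<Rightarrow> 'm vfield) \<Rightarrow> ('e \<Rightarrow> 'm \<Rightarrow> real) \<Rightarrow> bool" where
  "local_frame p W E \<xi> \<longleftrightarrow> open W \<and> p \<in> W \<and> (\<forall>b. E b \<in> vector_fields A) \<and>
     (\<forall>q\<in>W. \<forall>v\<in>tangent_space A q. \<exists>c. v = (\<Sum>b\<in>Basis. scale (c b) (E b q))) \<and>
     (\<forall>b. \<xi> b \<in> smooth_functions A) \<and>
     (\<exists>C. C \<noteq> 0 \<and> (\<forall>b\<in>Basis. \<forall>b'\<in>Basis. E b' p (\<xi> b) = (if b' = b then C else 0)))"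

lemma local_frame_exists:
  obtains W E \<xi> where "local_frame p W E \<xi>"
proof -
  obtain U \<phi> where c: "(U, \<phi>) \<in> A" "p \<in> U" by (rule chart_at)
  obtain \<kappa> where \<kappa>: "bump_in U \<kappa>" "\<kappa> p \<noteq> 0" using bump_exists[OF chart_open[OF c(1)] c(2)] by blast
  have "smooth_at A p \<kappa>" using bump_in_smooth[OF \<kappa>(1)] smooth_functions_iff by blast
  \<comment> \<open>Where \<kappa> is non-zero the cut-off coordinate fields still span, since
    \<kappa> can be divided out of the coefficients.\<close>
  then obtain N where N: "open N" "p \<in> N" "\<And>q. q \<in> N \<Longrightarrow> \<kappa> q \<noteq> 0"
    using smooth_at_nonzero_nhd \<kappa>(2) by blast
  have NU: "N \<subseteq> U" using N(3) bump_in_zero[OF \<kappa>(1)] by blast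
  define E where "E b q = scale (\<kappa> q) (if q \<in> U then coord_deriv U \<phi> q b else 0)" for b q
  define \<xi> where "\<xi> b q = \<kappa> q * ((\<phi> q + - \<phi> p) \<bullet> b)" for b q
  have \<xi>: "\<xi> b \<in> smooth_functions A" "coord_deriv U \<phi> p x (\<xi> b) = \<kappa> p * (x \<bullet> b)" for x b
    using cutoff_coordinates[OF c \<kappa>(1)] by (simp_all add: \<xi>_def[abs_def])
  have "\<exists>c. v = (\<Sum>b\<in>Basis. scale (c b) (E b q))" if q: "q \<in> N" and v: "v \<in> tangent_space A q" for q v
  proof -
    have qU: "q \<in> U" using q NU by blast
    obtain x where x: "v = coord_deriv U \<phi> q x" using coord_deriv_span[OF c(1) qU v] by blast
    have "v f = (\<Sum>b\<in>Basis. scale ((x \<bullet> b) / \<kappa> q) (E b q)) f" for f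
      unfolding x coord_deriv_expand[OF c(1) qU, of x f] sum_fun_apply
      using qU N(3)[OF q] by (intro sum.cong) (auto simp: E_def)
    then show ?thesis by (intro exI[of _ "\<lambda>b. (x \<bullet> b) / \<kappa> q"] ext)
  qed
  \<comment> \<open>One factor \<kappa> p comes from the field and the other from the cut-off
    coordinate.\<close>
  moreover have "E b' p (\<xi> b) = (if b' = b then \<kappa> p * \<kappa> p else 0)"
    if "b \<in> Basis" "b' \<in> Basis" for b b'
    using that c(2) by (simp add: E_def \<xi> inner_Basis)
  moreover have "\<kappa> p * \<kappa> p \<noteq> 0" using \<kappa>(2) by simp
  moreover have "E b \<in> vector_fields A" for b
    using coord_field_vector_field[OF c(1) \<kappa>(1)] by (simp add: E_def[abs_def])
  ultimately have "local_frame p N E \<xi>"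
    unfolding local_frame_def using N \<xi>(1) by blast
  then show thesis by (rule that)
qed

section \<open>The module of vector fields and expansion in a frame\<close>

lemma vector_field_tangent: "X \<in> vector_fields A \<Longrightarrow> X p \<in> tangent_space A p"
  by (simp add: vector_fields_def)

lemma vector_field_act: "X \<in> vector_fields A \<Longrightarrow> f \<in> smooth_functions A \<Longrightarrow> act X f \<in> smooth_functions A"
  by (simp add: vector_fields_def)

lemma vector_field_smooth_at: "X \<in> vector_fields A \<Longrightarrow> f \<in> smooth_functions A \<Longrightarrow> smooth_at A p (\<lambda>q. X q f)"
  using vector_field_act smooth_functions_iff unfolding act_def by blast

lemma vector_fields_add: "X \<in> vector_fields A \<Longrightarrow> Y \<in> vector_fields A \<Longrightarrow> X + Y \<in> vector_fields A"
proof -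
  assume X: "X \<in> vector_fields A" and Y: "Y \<in> vector_fields A"
  have "act (X + Y) f = act X f + act Y f" for f by (auto simp: act_def)
  then show ?thesis
    using X Y by (auto simp: vector_fields_def intro: tangent_add smooth_functions_add)
qed

lemma vector_fields_smul:
  assumes g: "g \<in> smooth_functions A" and X: "X \<in> vector_fields A"
  shows "smul g X \<in> vector_fields A"
proof -
  have "act (smul g X) f = g * act X f" for f by (auto simp: act_def smul_def)
  then show ?thesis
    using g X by (auto simp: vector_fields_def smul_def intro: tangent_scale smooth_functions_mult)
qed

lemma vector_fields_zero: "0 \<in> vector_fields A"
proof -
  have "act 0 f = (\<lambda>_. 0)" for f :: "'m \<Rightarrow> real" by (auto simp: act_def)
  then show ?thesis by (auto simp: vector_fields_def intro: tangent_zero smooth_functions_const)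
qed

lemma vector_fields_sum:
  "(\<And>i. i \<in> I \<Longrightarrow> X i \<in> vector_fields A) \<Longrightarrow> (\<Sum>i\<in>I. X i) \<in> vector_fields A"
  by (induction I rule: infinite_finite_induct) (auto intro: vector_fields_add vector_fields_zero)

context
  fixes p W E \<xi> assumes frame: "local_frame p W E \<xi>"
begin

lemma frame_open: "open W" and frame_mem: "p \<in> W" and frame_field: "E b \<in> vector_fields A"
  and frame_dual_smooth: "\<xi> b \<in> smooth_functions A"
  using frame by (auto simp: local_frame_def)

lemma frame_span:
  assumes "q \<in> W" "v \<in> tangent_space A q"
  obtains c where "v = (\<Sum>b\<in>Basis. scale (c b) (E b q))"
  using frame assms unfolding local_frame_def by blast

text \<open>The matrix with entries \<open>E b' p (\<xi> b)\<close> is a non-zero multiple of the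
  identity. The wording is that of the kernel hypothesis in
  \<open>smooth_at_solution\<close>.\<close>

lemma frame_independent:
  assumes "\<And>b. b \<in> Basis \<Longrightarrow> (\<Sum>b'\<in>Basis. E b' p (\<xi> b) * y b') = 0" "b \<in> Basis"
  shows "y b = 0"
proof -
  obtain C where C: "C \<noteq> 0"
    "\<And>b b'. b \<in> Basis \<Longrightarrow> b' \<in> Basis \<Longrightarrow> E b' p (\<xi> b) = (if b' = b then C else 0)"
    using frame unfolding local_frame_def by blast
  have "(\<Sum>b'\<in>Basis. E b' p (\<xi> b) * y b') = (\<Sum>b'\<in>Basis. if b' = b then C * y b' else 0)"
    using assms(2) by (intro sum.cong) (auto simp: C(2))
  then show ?thesis using assms C(1) by simp
qed

lemma frame_independent_sum:
  assumes "(\<Sum>b\<in>Basis. scale (y b) (E b p)) = 0" "b \<in> Basis"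
  shows "y b = 0"
proof (rule frame_independent[OF _ assms(2)])
  fix b
  have "(\<Sum>b\<in>Basis. scale (y b) (E b p)) (\<xi> b) = 0" using assms(1) by simp
  then show "(\<Sum>b'\<in>Basis. E b' p (\<xi> b) * y b') = 0"
    by (simp add: sum_fun_apply mult.commute)
qed

text \<open>Stated for arbitrary families of tangent vectors, because it is applied to
  \<open>sharp A h \<beta>\<close> before that is known to be a vector field.\<close>

lemma frame_expand_pointwise:
  assumes "\<And>q. X q \<in> tangent_space A q"
  obtains c where "\<And>q. q \<in> W \<Longrightarrow> X q = (\<Sum>b\<in>Basis. scale (c b q) (E b q))"
proof -
  have "\<forall>q\<in>W. \<exists>c. X q = (\<Sum>b\<in>Basis. scale (c b) (E b q))"
    using frame_span assms by metis
  then obtain c where "\<forall>q\<in>W. X q = (\<Sum>b\<in>Basis. scale (c q b) (E b q))" by metis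
  then show thesis by (intro that[of "\<lambda>b q. c q b"]) auto
qed

text \<open>Applying the expansion to the functions \<open>\<xi> b\<close> gives a linear system for
  the coefficients with smooth entries, invertible at \<open>p\<close>; elimination then makes the
  coefficients smooth there.\<close>

lemma frame_expand:
  assumes X: "X \<in> vector_fields A"
  obtains c where "\<And>q. q \<in> W \<Longrightarrow> X q = (\<Sum>b\<in>Basis. scale (c b q) (E b q))"
    and "\<And>b. b \<in> Basis \<Longrightarrow> smooth_at A p (c b)"
proof -
  obtain c where c: "\<And>q. q \<in> W \<Longrightarrow> X q = (\<Sum>b\<in>Basis. scale (c b q) (E b q))"
    using frame_expand_pointwise vector_field_tangent[OF X] by blast
  have "\<forall>b\<in>Basis. smooth_at A p (c b)"
  proof (rule smooth_at_solution[where I = Basis and a = "\<lambda>b b' q. E b' q (\<xi> b)"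
        and b = "\<lambda>b q. X q (\<xi> b)", OF _ frame_open frame_mem])
    show "(\<Sum>j\<in>Basis. E j q (\<xi> i) * c j q) = X q (\<xi> i)" if "q \<in> W" for i q
      using c[OF that] by (simp add: sum_fun_apply mult.commute)
  qed (auto intro: vector_field_smooth_at frame_field frame_dual_smooth X frame_independent)
  then show thesis using that c by blast
qed

end

text \<open>The frame fields are defined on the whole manifold, so constant coefficients already
  give an extension.\<close>

lemma vector_field_extends:
  assumes "u \<in> tangent_space A p"
  obtains X where "X \<in> vector_fields A" "X p = u"
proof -
  obtain W E \<xi> where fr: "local_frame p W E \<xi>" by (rule local_frame_exists)
  obtain c where c: "u = (\<Sum>b\<in>Basis. scale (c b) (E b p))"
    using frame_span[OF fr frame_mem[OF fr] assms] by blast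
  show thesis
  proof
    show "(\<Sum>b\<in>Basis. smul (\<lambda>_. c b) (E b)) \<in> vector_fields A"
      by (intro vector_fields_sum vector_fields_smul smooth_functions_const frame_field[OF fr])
    show "(\<Sum>b\<in>Basis. smul (\<lambda>_. c b) (E b)) p = u"
      unfolding c sum_fun_apply smul_apply ..
  qed
qed

end

section \<open>One-forms and tensoriality\<close>

context smooth_manifold
begin

section \<open>Covectors and one-forms\<close>

lemma cotangent_diff: "a \<in> cotangent_space A p \<Longrightarrow> b \<in> cotangent_space A p \<Longrightarrow> a - b \<in> cotangent_space A p"
  unfolding cotangent_space_def by (auto simp: algebra_simps)

lemma cotangent_zero: "0 \<in> cotangent_space A p"
  unfolding cotangent_space_def by auto

lemma cotangent_outside: "a \<in> cotangent_space A p \<Longrightarrow> u \<notin> tangent_space A p \<Longrightarrow> a u = 0"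
  unfolding cotangent_space_def by auto

lemma cotangent_eqI:
  assumes "a \<in> cotangent_space A p" "b \<in> cotangent_space A p"
    and "\<And>u. u \<in> tangent_space A p \<Longrightarrow> a u = b u"
  shows "a = b"
  using assms cotangent_outside by (metis ext)

context
  fixes a p assumes a: "a \<in> cotangent_space A p"
begin

lemma covector_add: "u \<in> tangent_space A p \<Longrightarrow> v \<in> tangent_space A p \<Longrightarrow> a (u + v) = a u + a v"
  using a unfolding cotangent_space_def by auto

lemma covector_scale: "u \<in> tangent_space A p \<Longrightarrow> a (scale c u) = c * a u"
  using a unfolding cotangent_space_def by auto

lemma covector_zero: "a 0 = 0"
proof -
  have "scale 0 0 = (0 :: 'm tvec)" by auto
  then show ?thesis using covector_scale[OF tangent_zero, of 0] by simp
qed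

lemma covector_sum:
  "(\<And>i. i \<in> I \<Longrightarrow> u i \<in> tangent_space A p) \<Longrightarrow>
    a (\<Sum>i\<in>I. scale (c i) (u i)) = (\<Sum>i\<in>I. c i * a (u i))"
proof (induction I rule: infinite_finite_induct)
  case (insert i I)
  have "a (scale (c i) (u i) + (\<Sum>i\<in>I. scale (c i) (u i))) =
      a (scale (c i) (u i)) + a (\<Sum>i\<in>I. scale (c i) (u i))"
    using insert.prems by (intro covector_add tangent_scale tangent_sum) auto
  moreover have "a (scale (c i) (u i)) = c i * a (u i)"
    using insert.prems by (intro covector_scale) auto
  moreover have "a (\<Sum>i\<in>I. scale (c i) (u i)) = (\<Sum>i\<in>I. c i * a (u i))"
    using insert by blast
  ultimately show ?case
    unfolding sum.insert[OF insert.hyps(1,2)] by presburger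
qed (auto simp: covector_zero)

end

lemma one_form_cotangent: "\<beta> \<in> one_forms A \<Longrightarrow> \<beta> p \<in> cotangent_space A p"
  by (simp add: one_forms_def)

lemma one_form_eval: "\<beta> \<in> one_forms A \<Longrightarrow> X \<in> vector_fields A \<Longrightarrow> eval_form \<beta> X \<in> smooth_functions A"
  by (simp add: one_forms_def)

lemma one_forms_diff: "\<alpha> \<in> one_forms A \<Longrightarrow> \<beta> \<in> one_forms A \<Longrightarrow> \<alpha> - \<beta> \<in> one_forms A"
proof -
  assume a: "\<alpha> \<in> one_forms A" "\<beta> \<in> one_forms A"
  have "eval_form (\<alpha> - \<beta>) X = eval_form \<alpha> X - eval_form \<beta> X" for X by (auto simp: eval_form_def)
  then show ?thesis using a by (simp add: one_forms_def cotangent_diff smooth_functions_diff)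
qed

lemma one_forms_zero: "0 \<in> one_forms A"
proof -
  have "eval_form 0 X = (\<lambda>_. 0)" for X :: "'m vfield" by (auto simp: eval_form_def)
  then show ?thesis by (auto simp: one_forms_def intro: cotangent_zero smooth_functions_const)
qed

lemma one_form_eqI:
  assumes "\<beta> \<in> one_forms A" "\<gamma> \<in> one_forms A"
    and "\<And>X. X \<in> vector_fields A \<Longrightarrow> eval_form \<beta> X = eval_form \<gamma> X"
  shows "\<beta> = \<gamma>"
proof
  fix p
  show "\<beta> p = \<gamma> p"
  proof (rule cotangent_eqI[OF one_form_cotangent[OF assms(1)] one_form_cotangent[OF assms(2)]])
    fix u assume "u \<in> tangent_space A p"
    then obtain X where X: "X \<in> vector_fields A" "X p = u" by (rule vector_field_extends)
    show "\<beta> p u = \<gamma> p u" using fun_cong[OF assms(3)[OF X(1)], of p] X(2) by (simp add: eval_form_def)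
  qed
qed

section \<open>Maps on vector fields that are linear over the smooth functions\<close>

context
  fixes L :: "'m vfield \<Rightarrow> 'm \<Rightarrow> real"
  assumes L_add: "\<And>X Y. X \<in> vector_fields A \<Longrightarrow> Y \<in> vector_fields A \<Longrightarrow> L (X + Y) = L X + L Y"
    and L_smul: "\<And>f X. f \<in> smooth_functions A \<Longrightarrow> X \<in> vector_fields A \<Longrightarrow> L (smul f X) = f * L X"
begin

lemma tensorial_zero: "L 0 = 0"
proof -
  have "smul (\<lambda>_. 0) 0 = (0 :: 'm vfield)" by (rule ext, rule ext) (simp add: smul_def)
  then have "L 0 = (\<lambda>_. 0) * L 0"
    using L_smul[OF smooth_functions_const vector_fields_zero, of 0] by metis
  also have "\<dots> = 0" by (rule ext) simp
  finally show ?thesis .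
qed

lemma tensorial_sum:
  "(\<And>i. i \<in> I \<Longrightarrow> X i \<in> vector_fields A) \<Longrightarrow> L (\<Sum>i\<in>I. X i) = (\<Sum>i\<in>I. L (X i))"
  by (induction I rule: infinite_finite_induct)
    (auto simp: tensorial_zero L_add vector_fields_sum)

text \<open>The local expansion of \<open>X\<close> becomes a global identity after multiplication
  by a bump function: \<kappa> X is a combination of frame fields with globally smooth coefficients
  that vanish at \<open>p\<close>. Linearity of \<open>L\<close> over functions then gives \<kappa>
  p * L X p = 0.\<close>

lemma tensorial_vanish:
  assumes X: "X \<in> vector_fields A" and Xp: "X p = 0"
  shows "L X p = 0"
proof -
  obtain W E \<xi> where fr: "local_frame p W E \<xi>" by (rule local_frame_exists)
  obtain c where c: "\<And>q. q \<in> W \<Longrightarrow> X q = (\<Sum>b\<in>Basis. scale (c b q) (E b q))"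
    "\<And>b. b \<in> Basis \<Longrightarrow> smooth_at A p (c b)"
    using frame_expand[OF fr X] by blast
  have c0: "c b p = 0" if "b \<in> Basis" for b
    using frame_independent_sum[OF fr _ that, of "\<lambda>b. c b p"] c(1)[OF frame_mem[OF fr]] Xp by simp
  \<comment> \<open>Smoothness of the coefficients at \<open>p\<close> spreads to neighbourhoods.
    Since \<open>Basis\<close> is finite, these have a common open intersection in which the bump
    can be supported.\<close>
  have "\<forall>b\<in>Basis. \<exists>N. open N \<and> p \<in> N \<and> (\<forall>q\<in>N. smooth_at A q (c b))"
    using c(2) by (metis smooth_at_nhd)
  then obtain N where N: "\<And>b. b \<in> Basis \<Longrightarrow> open (N b) \<and> p \<in> N b \<and> (\<forall>q\<in>N b. smooth_at A q (c b))"
    by metis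
  define M where "M = W \<inter> (\<Inter>b\<in>Basis. N b)"
  have M: "open M" "p \<in> M"
    unfolding M_def using N frame_open[OF fr] frame_mem[OF fr] by (auto intro!: open_Int open_INT)
  obtain \<kappa> where \<kappa>: "bump_in M \<kappa>" "\<kappa> p \<noteq> 0" using bump_exists[OF M] by blast
  define g where "g b = (\<lambda>q. \<kappa> q * c b q)" for b
  have g: "g b \<in> smooth_functions A" if "b \<in> Basis" for b
    unfolding g_def by (rule bump_in_mult[OF \<kappa>(1)]) (use N that in \<open>auto simp: M_def\<close>)
  have "smul \<kappa> X = (\<Sum>b\<in>Basis. smul (g b) (E b))"
  proof (rule ext, rule ext)
    fix q f
    show "smul \<kappa> X q f = (\<Sum>b\<in>Basis. smul (g b) (E b)) q f"
    proof (cases "q \<in> M")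
      case True
      then have "q \<in> W" by (simp add: M_def)
      then show ?thesis
        using c(1) by (simp add: smul_apply sum_fun_apply g_def sum_distrib_left mult.assoc)
    next
      case False
      then show ?thesis
        using bump_in_zero[OF \<kappa>(1)] by (simp add: smul_apply sum_fun_apply g_def)
    qed
  qed
  then have "\<kappa> * L X = (\<Sum>b\<in>Basis. g b * L (E b))"
    using L_smul[OF bump_in_smooth[OF \<kappa>(1)] X] g frame_field[OF fr]
    by (simp add: tensorial_sum vector_fields_smul L_smul)
  then have "\<kappa> p * L X p = (\<Sum>b\<in>Basis. g b p * L (E b) p)"
    by (metis (no_types, lifting) sum.cong sum_fun_apply times_fun_apply)
  also have "\<dots> = 0" using c0 by (simp add: g_def)
  finally show ?thesis using \<kappa>(2) by simp
qed

lemma tensorial_pointwise: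
  assumes X: "X \<in> vector_fields A" and Y: "Y \<in> vector_fields A" and eq: "X p = Y p"
  shows "L X p = L Y p"
proof -
  have mY: "smul (\<lambda>_. -1) Y \<in> vector_fields A"
    by (intro vector_fields_smul smooth_functions_const Y)
  have "(X + smul (\<lambda>_. -1) Y) p = 0" using eq by (auto simp: smul_apply)
  then have "L (X + smul (\<lambda>_. -1) Y) p = 0"
    by (rule tensorial_vanish[OF vector_fields_add[OF X mY]])
  then show ?thesis using L_add[OF X mY] L_smul[OF smooth_functions_const Y, of "-1"] by simp
qed

text \<open>The covector at \<open>p\<close> evaluates \<open>L\<close> on some global extension of
  the given tangent vector. By \<open>tensorial_pointwise\<close> the choice does not affect the
  value, which yields both linearity and agreement with \<open>L\<close>.\<close>

lemma tensorial_one_form: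
  assumes L_smooth: "\<And>X. X \<in> vector_fields A \<Longrightarrow> L X \<in> smooth_functions A"
  obtains \<gamma> where "\<gamma> \<in> one_forms A" "\<And>X. X \<in> vector_fields A \<Longrightarrow> eval_form \<gamma> X = L X"
proof -
  define ex where "ex p u = (SOME X. X \<in> vector_fields A \<and> X p = u)" for p and u :: "'m tvec"
  have ex: "ex p u \<in> vector_fields A" "ex p u p = u" if u: "u \<in> tangent_space A p" for p u
  proof -
    have "\<exists>X. X \<in> vector_fields A \<and> X p = u" using vector_field_extends[OF u] by blast
    then have "ex p u \<in> vector_fields A \<and> ex p u p = u" unfolding ex_def by (rule someI_ex)
    then show "ex p u \<in> vector_fields A" "ex p u p = u" by auto
  qed
  define \<gamma> where "\<gamma> p u = (if u \<in> tangent_space A p then L (ex p u) p else 0)" for p u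
  have ev: "\<gamma> p (X p) = L X p" if X: "X \<in> vector_fields A" for X p
    using tensorial_pointwise[OF ex(1)[OF vector_field_tangent[OF X]] X
        ex(2)[OF vector_field_tangent[OF X]]] vector_field_tangent[OF X] by (simp add: \<gamma>_def)
  have "\<gamma> p \<in> cotangent_space A p" for p
    unfolding cotangent_space_def
  proof (intro CollectI conjI ballI allI impI)
    fix u v assume u: "u \<in> tangent_space A p" and v: "v \<in> tangent_space A p"
    show "\<gamma> p (u + v) = \<gamma> p u + \<gamma> p v"
      using ev[OF vector_fields_add[OF ex(1)[OF u] ex(1)[OF v]], of p] ev[OF ex(1)[OF u], of p]
        ev[OF ex(1)[OF v], of p] L_add[OF ex(1)[OF u] ex(1)[OF v]] ex(2)[OF u] ex(2)[OF v]
      by simp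
  next
    fix c u assume u: "u \<in> tangent_space A p"
    show "\<gamma> p (scale c u) = c * \<gamma> p u"
      using ev[OF vector_fields_smul[OF smooth_functions_const ex(1)[OF u]], of p]
        ev[OF ex(1)[OF u], of p] L_smul[OF smooth_functions_const ex(1)[OF u], of c] ex(2)[OF u]
      by (simp add: smul_apply)
  qed (simp add: \<gamma>_def)
  moreover have "eval_form \<gamma> X = L X" if "X \<in> vector_fields A" for X
    using ev[OF that] by (auto simp: eval_form_def)
  ultimately show thesis
    using that[of \<gamma>] L_smooth by (simp add: one_forms_def)
qed

end

section \<open>The covariant derivative of a one-form\<close>

context
  fixes X :: "'m vfield" assumes X: "X \<in> vector_fields A"
begin

lemma act_add:
  "f \<in> smooth_functions A \<Longrightarrow> g \<in> smooth_functions A \<Longrightarrow> act X (f + g) = act X f + act X g"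
  using derivation_add[OF vector_field_tangent[OF X]] by (auto simp: act_def)

lemma act_mult:
  "f \<in> smooth_functions A \<Longrightarrow> g \<in> smooth_functions A \<Longrightarrow> act X (f * g) = f * act X g + g * act X f"
  using derivation_mult[OF vector_field_tangent[OF X]] by (auto simp: act_def)

lemma eval_form_add:
  "\<beta> \<in> one_forms A \<Longrightarrow> Y \<in> vector_fields A \<Longrightarrow> eval_form \<beta> (X + Y) = eval_form \<beta> X + eval_form \<beta> Y"
  using covector_add[OF one_form_cotangent vector_field_tangent[OF X] vector_field_tangent]
  by (auto simp: eval_form_def)

lemma eval_form_smul: "\<beta> \<in> one_forms A \<Longrightarrow> eval_form \<beta> (smul f X) = f * eval_form \<beta> X"
  using covector_scale[OF one_form_cotangent vector_field_tangent[OF X]]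
  by (auto simp: eval_form_def smul_apply)

end

text \<open>The term X(f) \<beta>(Y) arises once from the derivation and once from the connection,
  and the two cancel. The defining expression is therefore linear over functions in Y and comes from
  a one-form; \<open>one_form_eqI\<close> supplies the uniqueness demanded by
  \<open>THE\<close>.\<close>

lemma cov_form:
  assumes N: "affine_connection A N" and X: "X \<in> vector_fields A" and \<beta>: "\<beta> \<in> one_forms A"
  shows "cov_form A N X \<beta> \<in> one_forms A"
    and "Y \<in> vector_fields A \<Longrightarrow>
      eval_form (cov_form A N X \<beta>) Y = act X (eval_form \<beta> Y) - eval_form \<beta> (N X Y)"
proof -
  let ?L = "\<lambda>Y. act X (eval_form \<beta> Y) - eval_form \<beta> (N X Y)"
  have NX: "N X Y \<in> vector_fields A" if "Y \<in> vector_fields A" for Y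
    using N X that unfolding affine_connection_def by blast
  have L_add: "?L (Y + Z) = ?L Y + ?L Z" if Y: "Y \<in> vector_fields A" and Z: "Z \<in> vector_fields A" for Y Z
  proof -
    have "N X (Y + Z) = N X Y + N X Z"
      using N X Y Z unfolding affine_connection_def by blast
    then show ?thesis
      by (simp add: eval_form_add[OF Y \<beta> Z] eval_form_add[OF NX[OF Y] \<beta> NX[OF Z]]
          act_add[OF X one_form_eval[OF \<beta> Y] one_form_eval[OF \<beta> Z]])
  qed
  have L_smul: "?L (smul f Y) = f * ?L Y" if f: "f \<in> smooth_functions A" and Y: "Y \<in> vector_fields A" for f Y
  proof -
    have "N X (smul f Y) = smul (act X f) Y + smul f (N X Y)"
      using N X Y f unfolding affine_connection_def by blast
    then have "eval_form \<beta> (N X (smul f Y)) = act X f * eval_form \<beta> Y + f * eval_form \<beta> (N X Y)"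
      using eval_form_add[OF vector_fields_smul[OF vector_field_act[OF X f] Y] \<beta>
          vector_fields_smul[OF f NX[OF Y]]]
      by (simp add: eval_form_smul[OF Y \<beta>] eval_form_smul[OF NX[OF Y] \<beta>])
    moreover have "act X (eval_form \<beta> (smul f Y)) = f * act X (eval_form \<beta> Y) + eval_form \<beta> Y * act X f"
      by (simp add: eval_form_smul[OF Y \<beta>] act_mult[OF X f one_form_eval[OF \<beta> Y]])
    ultimately show ?thesis by (auto simp: fun_eq_iff algebra_simps)
  qed
  have L_smooth: "?L Y \<in> smooth_functions A" if Y: "Y \<in> vector_fields A" for Y
    by (intro smooth_functions_diff vector_field_act X one_form_eval \<beta> Y NX)
  obtain \<gamma> where \<gamma>: "\<gamma> \<in> one_forms A" "\<And>Y. Y \<in> vector_fields A \<Longrightarrow> eval_form \<gamma> Y = ?L Y"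
    by (rule tensorial_one_form[of ?L, OF L_add L_smul L_smooth]) auto
  have "cov_form A N X \<beta> = \<gamma>"
    unfolding cov_form_def
  proof (rule the_equality)
    fix \<gamma>' assume "\<gamma>' \<in> one_forms A \<and> (\<forall>Y\<in>vector_fields A. eval_form \<gamma>' Y = ?L Y)"
    then show "\<gamma>' = \<gamma>" using \<gamma> by (intro one_form_eqI) auto
  qed (use \<gamma> in blast)
  then show "cov_form A N X \<beta> \<in> one_forms A"
    and "Y \<in> vector_fields A \<Longrightarrow> eval_form (cov_form A N X \<beta>) Y = ?L Y"
    using \<gamma> by auto
qed

end

section \<open>Non-degenerate tensor fields\<close>

locale nondegenerate_tensor = smooth_manifold +
  fixes h :: "'a tensor02"
  assumes tensor: "tensor02_field A h" and nondeg: "nondegenerate A h"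
begin

lemma tensor_cotangent: "u \<in> tangent_space A p \<Longrightarrow> h p u \<in> cotangent_space A p"
  using tensor unfolding tensor02_field_def by blast

lemma tensor_add:
  "u \<in> tangent_space A p \<Longrightarrow> v \<in> tangent_space A p \<Longrightarrow> h p (u + v) = h p u + h p v"
  using tensor unfolding tensor02_field_def by blast

lemma tensor_scale: "u \<in> tangent_space A p \<Longrightarrow> h p (scale c u) = scale c (h p u)"
  using tensor unfolding tensor02_field_def by blast

lemma tensor_smooth:
  "X \<in> vector_fields A \<Longrightarrow> Y \<in> vector_fields A \<Longrightarrow> eval02 h X Y \<in> smooth_functions A"
  using tensor unfolding tensor02_field_def by blast

lemma tensor_zero: "h p 0 = 0"
proof -
  have "scale 0 u = 0" for u :: "'x \<Rightarrow> real" by auto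
  then show ?thesis using tensor_scale[OF tangent_zero, of p 0] by metis
qed

lemma tensor_nondegenerate:
  "u \<in> tangent_space A p \<Longrightarrow> (\<And>v. v \<in> tangent_space A p \<Longrightarrow> h p u v = 0) \<Longrightarrow> u = 0"
  using nondeg unfolding nondegenerate_def by blast

lemma tensor_sum:
  "(\<And>i. i \<in> I \<Longrightarrow> u i \<in> tangent_space A p) \<Longrightarrow>
    h p (\<Sum>i\<in>I. scale (c i) (u i)) v = (\<Sum>i\<in>I. h p (u i) v * c i)"
proof (induction I rule: infinite_finite_induct)
  case (insert i I)
  let ?s = "\<Sum>i\<in>I. scale (c i) (u i)"
  have "h p (scale (c i) (u i) + ?s) = h p (scale (c i) (u i)) + h p ?s"
    using insert.prems by (intro tensor_add tangent_scale tangent_sum) auto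
  also have "h p (scale (c i) (u i)) = scale (c i) (h p (u i))"
    using insert.prems by (intro tensor_scale) auto
  finally have "h p (scale (c i) (u i) + ?s) v = (scale (c i) (h p (u i)) + h p ?s) v"
    by (rule fun_cong)
  also have "\<dots> = h p (u i) v * c i + h p ?s v"
    by (subst plus_fun_apply) (simp only: scale_apply mult.commute)
  also have "h p ?s v = (\<Sum>i\<in>I. h p (u i) v * c i)"
    using insert by blast
  finally show ?case
    unfolding sum.insert[OF insert.hyps(1,2)] .
qed (auto simp: tensor_zero)

lemma tensor_inj:
  assumes "u \<in> tangent_space A p" "v \<in> tangent_space A p" "h p u = h p v"
  shows "u = v"
proof -
  have mv: "scale (-1) v \<in> tangent_space A p" by (rule tangent_scale[OF assms(2)])
  have "u + scale (-1) v = 0"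
    by (rule tensor_nondegenerate[OF tangent_add[OF assms(1) mv]])
      (use assms mv in \<open>simp add: tensor_add tensor_scale\<close>)
  then show ?thesis by (auto simp: fun_eq_iff)
qed

text \<open>The system says that the tangent vector with frame coordinates \<open>y\<close> is
  paired to zero with every frame vector, hence with every tangent vector, so non-degeneracy kills
  it. It serves both the surjectivity of \<open>h p\<close> and the elimination that makes
  \<open>sharp\<close> smooth.\<close>

lemma frame_tensor_independent:
  assumes fr: "local_frame p W E \<xi>"
    and y: "\<And>b'. b' \<in> Basis \<Longrightarrow> (\<Sum>b\<in>Basis. h p (E b p) (E b' p) * y b) = 0" and b: "b \<in> Basis"
  shows "y b = 0"
proof (rule frame_independent_sum[OF fr _ b])
  have E: "E b p \<in> tangent_space A p" for b
    using vector_field_tangent[OF frame_field[OF fr]] .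
  let ?u = "\<Sum>b\<in>Basis. scale (y b) (E b p)"
  have u: "?u \<in> tangent_space A p" by (intro tangent_sum tangent_scale E)
  show "?u = 0"
  proof (rule tensor_nondegenerate[OF u])
    fix v assume "v \<in> tangent_space A p"
    then obtain c where c: "v = (\<Sum>b\<in>Basis. scale (c b) (E b p))"
      using frame_span[OF fr frame_mem[OF fr]] by blast
    have "h p ?u (E b' p) = 0" if "b' \<in> Basis" for b'
      using tensor_sum[of Basis "\<lambda>b. E b p" p y] E y[OF that] by simp
    then show "h p ?u v = 0"
      unfolding c using covector_sum[OF tensor_cotangent[OF u], of Basis "\<lambda>b. E b p" c] E by simp
  qed
qed

text \<open>Injectivity of \<open>h\<close> gives surjectivity because a frame identifies the tangent space with the
  Euclidean model space.\<close>

lemma tensor_surj: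
  assumes a: "a \<in> cotangent_space A p"
  obtains u where "u \<in> tangent_space A p" "h p u = a"
proof -
  obtain W E \<xi> where fr: "local_frame p W E \<xi>" by (rule local_frame_exists)
  have E: "E b p \<in> tangent_space A p" for b
    using vector_field_tangent[OF frame_field[OF fr]] .
  \<comment> \<open>The matrix of \<open>h p\<close> in the frame, as an endomorphism of the model
    space, where injective linear maps are surjective.\<close>
  define F where "F x = (\<Sum>b'\<in>Basis. (\<Sum>b\<in>Basis. h p (E b p) (E b' p) * (x \<bullet> b)) *\<^sub>R b')" for x
  have F_inner: "F x \<bullet> b' = (\<Sum>b\<in>Basis. h p (E b p) (E b' p) * (x \<bullet> b))" if "b' \<in> Basis" for x b'
    using that by (simp add: F_def)
  have lin: "linear F"
    by (rule linearI; rule euclidean_eqI)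
      (simp_all add: F_inner inner_add_left distrib_left sum.distrib sum_distrib_left
        mult.left_commute)
  have "inj F"
    unfolding linear_injective_0[OF lin]
  proof (intro allI impI)
    fix x assume "F x = 0"
    then have "(\<Sum>b\<in>Basis. h p (E b p) (E b' p) * (x \<bullet> b)) = 0" if "b' \<in> Basis" for b'
      using F_inner[OF that, of x] by simp
    then have "x \<bullet> b = 0" if "b \<in> Basis" for b
      using frame_tensor_independent[OF fr _ that, of "\<lambda>b. x \<bullet> b"] by blast
    then show "x = 0" by (simp add: euclidean_eq_iff[of x 0])
  qed
  then have "surj F" using linear_injective_imp_surjective[OF lin] by blast
  \<comment> \<open>The target vector lists the values of \<open>a\<close> on the frame, so
    \<open>x\<close> holds the frame coordinates of the preimage.\<close>
  then obtain x where x: "F x = (\<Sum>b\<in>Basis. a (E b p) *\<^sub>R b)" by (metis surjD)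
  let ?u = "\<Sum>b\<in>Basis. scale (x \<bullet> b) (E b p)"
  have u: "?u \<in> tangent_space A p" by (intro tangent_sum tangent_scale E)
  have hE: "h p ?u (E b' p) = a (E b' p)" if "b' \<in> Basis" for b'
    using tensor_sum[of Basis "\<lambda>b. E b p" p "\<lambda>b. x \<bullet> b"] E F_inner[OF that, of x] that
    by (simp add: x)
  have "h p ?u = a"
  proof (rule cotangent_eqI[OF tensor_cotangent[OF u] a])
    fix v assume "v \<in> tangent_space A p"
    then obtain c where c: "v = (\<Sum>b\<in>Basis. scale (c b) (E b p))"
      using frame_span[OF fr frame_mem[OF fr]] by blast
    show "h p ?u v = a v"
      unfolding c using covector_sum[OF tensor_cotangent[OF u], of Basis "\<lambda>b. E b p" c]
        covector_sum[OF a, of Basis "\<lambda>b. E b p" c] E hE by simp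
  qed
  with u show thesis by (rule that)
qed

section \<open>The inverse of h on covectors and on one-forms\<close>

lemma sharp_at:
  assumes "a \<in> cotangent_space A p"
  shows sharp_at_tangent: "sharp_at A h p a \<in> tangent_space A p"
    and flat_sharp_at: "h p (sharp_at A h p a) = a"
proof -
  have "a \<in> h p ` tangent_space A p" using tensor_surj[OF assms] by blast
  then show "sharp_at A h p a \<in> tangent_space A p" "h p (sharp_at A h p a) = a"
    unfolding sharp_at_def by (rule inv_into_into, rule f_inv_into_f)
qed

text \<open>Linearity of \<open>sharp_at\<close> is read off from that of \<open>h\<close> through
  this criterion.\<close>

lemma sharp_at_eqI:
  assumes "u \<in> tangent_space A p" "h p u = a"
  shows "sharp_at A h p a = u"
  using assms tensor_inj tensor_cotangent sharp_at by metis

lemma sharp_at_add: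
  "a \<in> cotangent_space A p \<Longrightarrow> b \<in> cotangent_space A p \<Longrightarrow>
    sharp_at A h p (a + b) = sharp_at A h p a + sharp_at A h p b"
  by (rule sharp_at_eqI) (simp_all add: tangent_add tensor_add sharp_at)

lemma sharp_at_scale:
  "a \<in> cotangent_space A p \<Longrightarrow> sharp_at A h p (scale c a) = scale c (sharp_at A h p a)"
  by (rule sharp_at_eqI) (simp_all add: tangent_scale tensor_scale sharp_at)

lemma sharp_at_zero: "sharp_at A h p 0 = 0"
  by (rule sharp_at_eqI) (simp_all add: tangent_zero tensor_zero)

text \<open>In a local frame the coefficients of h^-1(\<beta>) solve the system obtained by pairing
  with the frame fields. Its entries h(E_b, E_b') and right-hand sides \<beta>(E_b') are smooth, so
  \<open>smooth_at_solution\<close> applies.\<close>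

lemma sharp_vector_field:
  assumes \<beta>: "\<beta> \<in> one_forms A"
  shows "sharp A h \<beta> \<in> vector_fields A"
proof -
  have T: "sharp A h \<beta> q \<in> tangent_space A q" for q
    unfolding sharp_def by (rule sharp_at_tangent[OF one_form_cotangent[OF \<beta>]])
  have hs: "h q (sharp A h \<beta> q) = \<beta> q" for q
    unfolding sharp_def by (rule flat_sharp_at[OF one_form_cotangent[OF \<beta>]])
  have "smooth_at A p (\<lambda>q. sharp A h \<beta> q f)" if f: "f \<in> smooth_functions A" for p f
  proof -
    obtain W E \<xi> where fr: "local_frame p W E \<xi>" by (rule local_frame_exists)
    note E = frame_field[OF fr]
    obtain c where c: "\<And>q. q \<in> W \<Longrightarrow> sharp A h \<beta> q = (\<Sum>b\<in>Basis. scale (c b q) (E b q))"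
      using frame_expand_pointwise[OF fr T] by blast
    have "\<forall>b\<in>Basis. smooth_at A p (c b)"
    proof (rule smooth_at_solution[where I = Basis and a = "\<lambda>b' b. eval02 h (E b) (E b')"
          and b = "\<lambda>b'. eval_form \<beta> (E b')", OF _ frame_open[OF fr] frame_mem[OF fr]])
      show "smooth_at A p (eval02 h (E j) (E i))" for i j
        using tensor_smooth[OF E E] smooth_functions_iff by blast
      show "smooth_at A p (eval_form \<beta> (E i))" for i
        using one_form_eval[OF \<beta> E] smooth_functions_iff by blast
      show "(\<Sum>j\<in>Basis. eval02 h (E j) (E i) q * c j q) = eval_form \<beta> (E i) q" if "q \<in> W" for i q
        using tensor_sum[of Basis "\<lambda>b. E b q" q "\<lambda>b. c b q" "E i q"] vector_field_tangent[OF E]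
          c[OF that] hs[of q]
        by (simp add: eval02_def eval_form_def)
      show "y j = 0" if "\<And>i. i \<in> Basis \<Longrightarrow> (\<Sum>j\<in>Basis. eval02 h (E j) (E i) p * y j) = 0" "j \<in> Basis" for y j
        using frame_tensor_independent[OF fr _ that(2)] that(1) by (simp add: eval02_def)
    qed auto
    then have "smooth_at A p (\<lambda>q. \<Sum>b\<in>Basis. c b q * E b q f)"
      by (intro smooth_at_sum smooth_at_mult vector_field_smooth_at[OF E f]) auto
    then show ?thesis
      by (rule smooth_at_cong[OF _ frame_open[OF fr] frame_mem[OF fr]]) (simp add: c sum_fun_apply)
  qed
  then show ?thesis
    using T by (simp add: vector_fields_def smooth_functions_iff act_def)
qed

lemma flat_one_form: "X \<in> vector_fields A \<Longrightarrow> flat h X \<in> one_forms A"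
  using tensor_smooth
  by (auto simp: one_forms_def flat_def eval_form_def eval02_def intro: tensor_cotangent vector_field_tangent)

lemma flat_add: "X \<in> vector_fields A \<Longrightarrow> Y \<in> vector_fields A \<Longrightarrow> flat h (X + Y) = flat h X + flat h Y"
  by (rule ext, rule ext) (simp add: flat_def tensor_add vector_field_tangent)

lemma flat_smul: "X \<in> vector_fields A \<Longrightarrow> flat h (smul f X) = smul f (flat h X)"
  by (rule ext, rule ext) (simp add: flat_def smul_apply tensor_scale vector_field_tangent)

lemma flat_sharp: "\<beta> \<in> one_forms A \<Longrightarrow> flat h (sharp A h \<beta>) = \<beta>"
  by (rule ext) (simp add: flat_def sharp_def flat_sharp_at one_form_cotangent)

lemma sharp_flat: "X \<in> vector_fields A \<Longrightarrow> sharp A h (flat h X) = X"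
  by (rule ext) (simp add: flat_def sharp_def sharp_at_eqI vector_field_tangent)

lemma sharp_add:
  "\<alpha> \<in> one_forms A \<Longrightarrow> \<beta> \<in> one_forms A \<Longrightarrow> sharp A h (\<alpha> + \<beta>) = sharp A h \<alpha> + sharp A h \<beta>"
  by (rule ext) (simp add: sharp_def sharp_at_add one_form_cotangent)

lemma sharp_smul: "\<beta> \<in> one_forms A \<Longrightarrow> sharp A h (smul f \<beta>) = smul f (sharp A h \<beta>)"
  by (rule ext) (simp add: sharp_def smul_apply sharp_at_scale one_form_cotangent)

lemma eval02_sharp:
  assumes "\<And>p. \<eta> p \<in> cotangent_space A p"
  shows "eval02 h (sharp A h \<eta>) Y = eval_form \<eta> Y"
  using assms by (auto simp: eval02_def sharp_def eval_form_def flat_sharp_at)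

end

section \<open>The induced structure on the generalized tangent bundle\<close>

context nondegenerate_tensor
begin

section \<open>The lifted bilinear form\<close>

lemma gbilinear_h_check: "gbilinear_form A (h_check A h)"
  unfolding gbilinear_form_def
proof (intro conjI allI ballI)
  fix p c x y z
  assume x: "x \<in> gspace A p" and y: "y \<in> gspace A p"
  note sp = sharp_at_tangent[of _ p]
  have xs: "fst x \<in> tangent_space A p" "snd x \<in> cotangent_space A p"
    and ys: "fst y \<in> tangent_space A p" "snd y \<in> cotangent_space A p"
    using x y by (auto simp: gspace_def)
  show "h_check A h p (gscale c x) y = c * h_check A h p x y"
    using xs ys by (simp add: h_check_def gscale_def sharp_at_scale tensor_scale sp algebra_simps)
  show "h_check A h p x (gscale c y) = c * h_check A h p x y"
    using xs ys by (simp add: h_check_def gscale_def sharp_at_scale sp algebra_simps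
        covector_scale[OF tensor_cotangent])
  assume z: "z \<in> gspace A p"
  have zs: "fst z \<in> tangent_space A p" "snd z \<in> cotangent_space A p"
    using z by (auto simp: gspace_def)
  show "h_check A h p (x + y) z = h_check A h p x z + h_check A h p y z"
    using xs ys zs by (simp add: h_check_def sharp_at_add tensor_add sp)
  show "h_check A h p z (x + y) = h_check A h p z x + h_check A h p z y"
    using xs ys zs by (simp add: h_check_def sharp_at_add sp covector_add[OF tensor_cotangent])
next
  fix \<sigma> \<tau> assume "\<sigma> \<in> gsections A" "\<tau> \<in> gsections A"
  then have "eval02 h (fst \<sigma>) (fst \<tau>) +
      eval02 h (sharp A h (snd \<sigma>)) (sharp A h (snd \<tau>)) \<in> smooth_functions A"
    by (intro smooth_functions_add tensor_smooth sharp_vector_field) (auto simp: gsections_def)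
  moreover have "geval (h_check A h) \<sigma> \<tau> = eval02 h (fst \<sigma>) (fst \<tau>) +
      eval02 h (sharp A h (snd \<sigma>)) (sharp A h (snd \<tau>))"
    by (rule ext) (simp add: geval_def h_check_def eval02_def sharp_def)
  ultimately show "geval (h_check A h) \<sigma> \<tau> \<in> smooth_functions A" by simp
qed

text \<open>The form is block diagonal: testing against (v, 0) isolates the tangent block, and
  testing against (0, h(v)) isolates the cotangent block, since h^-1 returns v.\<close>

lemma gnondegenerate_h_check: "gnondegenerate A (h_check A h)"
  unfolding gnondegenerate_def
proof (intro allI ballI impI)
  fix p x assume x: "x \<in> gspace A p" and 0: "\<forall>y\<in>gspace A p. h_check A h p x y = 0"
  have xs: "fst x \<in> tangent_space A p" "snd x \<in> cotangent_space A p"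
    using x by (auto simp: gspace_def)
  have "fst x = 0"
  proof (rule tensor_nondegenerate[OF xs(1)])
    fix v assume v: "v \<in> tangent_space A p"
    then have "h_check A h p x (v, 0) = 0" using 0 cotangent_zero by (simp add: gspace_def)
    then show "h p (fst x) v = 0"
      by (simp add: h_check_def sharp_at_zero
          covector_zero[OF tensor_cotangent[OF sharp_at_tangent[OF xs(2)]]])
  qed
  moreover have "sharp_at A h p (snd x) = 0"
  proof (rule tensor_nondegenerate[OF sharp_at_tangent[OF xs(2)]])
    fix v assume v: "v \<in> tangent_space A p"
    then have "h_check A h p x (0, h p v) = 0"
      using 0 tangent_zero tensor_cotangent by (simp add: gspace_def)
    then show "h p (sharp_at A h p (snd x)) v = 0"
      using v by (simp add: h_check_def sharp_at_eqI covector_zero[OF tensor_cotangent[OF xs(1)]])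
  qed
  then have "snd x = 0" using flat_sharp_at[OF xs(2)] tensor_zero by metis
  ultimately show "x = 0" by (simp add: prod_eq_iff)
qed

lemma geval_h_check:
  "geval (h_check A h) (X, \<alpha>) (Y, \<beta>) = eval02 h X Y + eval02 h (sharp A h \<alpha>) (sharp A h \<beta>)"
  by (rule ext) (simp add: geval_def h_check_def eval02_def sharp_def)

section \<open>The lifted connection and its exterior covariant derivative\<close>

context
  fixes N assumes conn: "affine_connection A N"
begin

lemma connection_field: "X \<in> vector_fields A \<Longrightarrow> Y \<in> vector_fields A \<Longrightarrow> N X Y \<in> vector_fields A"
  and connection_add_left: "X \<in> vector_fields A \<Longrightarrow> X' \<in> vector_fields A \<Longrightarrow> Y \<in> vector_fields A \<Longrightarrow>
    N (X + X') Y = N X Y + N X' Y"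
  and connection_add_right: "X \<in> vector_fields A \<Longrightarrow> Y \<in> vector_fields A \<Longrightarrow> Y' \<in> vector_fields A \<Longrightarrow>
    N X (Y + Y') = N X Y + N X Y'"
  and connection_const_right: "X \<in> vector_fields A \<Longrightarrow> Y \<in> vector_fields A \<Longrightarrow>
    N X (smul (\<lambda>_. c) Y) = smul (\<lambda>_. c) (N X Y)"
  and connection_smul_left: "f \<in> smooth_functions A \<Longrightarrow> X \<in> vector_fields A \<Longrightarrow> Y \<in> vector_fields A \<Longrightarrow>
    N (smul f X) Y = smul f (N X Y)"
  and connection_smul_right: "f \<in> smooth_functions A \<Longrightarrow> X \<in> vector_fields A \<Longrightarrow> Y \<in> vector_fields A \<Longrightarrow>
    N X (smul f Y) = smul (act X f) Y + smul f (N X Y)"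
  using conn unfolding affine_connection_def by blast+

text \<open>The cotangent part is the given connection conjugated by h. Both h and its inverse are
  linear over functions, so the Leibniz rule is transported, with h(h^-1(\<beta>)) = \<beta> in the
  term containing the derivative of the function.\<close>

lemma gaffine_nabla_hat: "gaffine_connection A (nabla_hat A h N)"
proof -
  note fields = vector_fields_add vector_fields_smul vector_field_act connection_field
    sharp_vector_field smooth_functions_const
  note rules = nabla_hat_def gsections_def gsmul_def gact_def prod_eq_iff fields flat_one_form
    connection_add_left connection_add_right connection_const_right connection_smul_left
    connection_smul_right sharp_add sharp_smul flat_add flat_smul flat_sharp
  show ?thesis
    unfolding gaffine_connection_def by (auto simp: rules)
qed

lemma gd_bilinear_h_check:
  assumes X: "X \<in> vector_fields A" and Y: "Y \<in> vector_fields A" and Z: "Z \<in> vector_fields A"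
    and \<alpha>: "\<alpha> \<in> one_forms A" and \<beta>: "\<beta> \<in> one_forms A" and \<gamma>: "\<gamma> \<in> one_forms A"
  shows "gd_bilinear A N (nabla_hat A h N) (h_check A h) (X, \<alpha>) (Y, \<beta>) (Z, \<gamma>) = d_tensor N h X Y Z"
proof -
  define V W U where VWU: "V = sharp A h \<alpha>" "W = sharp A h \<beta>" "U = sharp A h \<gamma>"
  have V: "V \<in> vector_fields A" and W: "W \<in> vector_fields A" and U: "U \<in> vector_fields A"
    unfolding VWU by (intro sharp_vector_field \<alpha> \<beta> \<gamma>)+
  have \<alpha>V: "\<alpha> = flat h V" and \<beta>W: "\<beta> = flat h W" using \<alpha> \<beta> by (simp_all add: VWU flat_sharp)
  \<comment> \<open>The form \<alpha>' is arbitrary because the direction of differentiation enters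
    only through its vector part.\<close>
  have gcov: "gcov_bilinear (nabla_hat A h N) (h_check A h) (X', \<alpha>') (Y', flat h W') (Z, \<gamma>) =
      cov_tensor N h X' Y' Z + cov_tensor N h X' W' U"
    if X': "X' \<in> vector_fields A" and Y': "Y' \<in> vector_fields A" and W': "W' \<in> vector_fields A"
    for X' Y' W' \<alpha>'
  proof -
    have "act X' (eval02 h Y' Z + eval02 h W' U) = act X' (eval02 h Y' Z) + act X' (eval02 h W' U)"
      by (rule act_add[OF X' tensor_smooth[OF Y' Z] tensor_smooth[OF W' U]])
    then show ?thesis
      by (simp add: gcov_bilinear_def cov_tensor_def gact_def nabla_hat_def geval_h_check sharp_flat
          W' connection_field[OF X' W'] connection_field[OF X' U] algebra_simps flip: VWU(3))
  qed
  have cov: "eval_form (cov_form A N X' (flat h W')) U = act X' (eval02 h W' U) - eval02 h W' (N X' U)"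
    if X': "X' \<in> vector_fields A" and W': "W' \<in> vector_fields A" for X' W'
    using cov_form(2)[OF conn X' flat_one_form[OF W'] U]
    by (simp add: eval_form_def eval02_def flat_def)
  \<comment> \<open>The cotangent part of the torsion. It has to be shown to consist of covectors,
    because \<open>sharp\<close> inverts h only on these.\<close>
  define \<eta> where "\<eta> = flat h (N X W) - flat h (N Y V) - (cov_form A N X \<beta> - cov_form A N Y \<alpha>)"
  have \<eta>: "\<eta> \<in> one_forms A"
    unfolding \<eta>_def
    by (intro one_forms_diff flat_one_form connection_field X Y V W cov_form(1)[OF conn] \<alpha> \<beta>)
  have tors: "gtorsion A N (nabla_hat A h N) (X, \<alpha>) (Y, \<beta>) = (torsion N X Y, \<eta>)"
    by (simp add: gtorsion_def nabla_hat_def gbracket_def torsion_def \<eta>_def VWU)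
  have "eval02 h (sharp A h \<eta>) U = eval_form \<eta> U" by (rule eval02_sharp[OF one_form_cotangent[OF \<eta>]])
  also have "\<dots> = eval02 h (N X W) U - eval02 h (N Y V) U -
      (eval_form (cov_form A N X \<beta>) U - eval_form (cov_form A N Y \<alpha>) U)"
    by (rule ext) (simp add: \<eta>_def eval_form_def eval02_def flat_def)
  also have "\<dots> = cov_tensor N h Y V U - cov_tensor N h X W U"
    unfolding \<alpha>V \<beta>W cov[OF X W] cov[OF Y V] cov_tensor_def by (simp add: algebra_simps)
  finally have e: "eval02 h (sharp A h \<eta>) U = cov_tensor N h Y V U - cov_tensor N h X W U" .
  show ?thesis
    unfolding gd_bilinear_def tors geval_h_check e d_tensor_def VWU(3)[symmetric]
    unfolding \<alpha>V \<beta>W gcov[OF X Y W] gcov[OF Y X V] by (simp add: algebra_simps)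
qed

text \<open>For the forward direction the sections (X, 0), (Y, 0), (Z, 0) suffice, as the lifted
  tensor equals the one on the base whatever the forms are; the same identity on all sections gives
  the converse.\<close>

lemma gquasi_statistical_iff:
  "gquasi_statistical A N (h_check A h) (nabla_hat A h N) \<longleftrightarrow> quasi_statistical A h N"
proof
  assume g: "gquasi_statistical A N (h_check A h) (nabla_hat A h N)"
  have "d_tensor N h X Y Z = 0"
    if "X \<in> vector_fields A" "Y \<in> vector_fields A" "Z \<in> vector_fields A" for X Y Z
  proof -
    have "gd_bilinear A N (nabla_hat A h N) (h_check A h) (X, 0) (Y, 0) (Z, 0) = 0"
      using g that one_forms_zero unfolding gquasi_statistical_def by (simp add: gsections_def)
    then show ?thesis using gd_bilinear_h_check that one_forms_zero by simp
  qed
  then show "quasi_statistical A h N"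
    using tensor nondeg conn by (simp add: quasi_statistical_def)
next
  assume "quasi_statistical A h N"
  then show "gquasi_statistical A N (h_check A h) (nabla_hat A h N)"
    unfolding gquasi_statistical_def quasi_statistical_def gsections_def
    using gbilinear_h_check gnondegenerate_h_check gaffine_nabla_hat gd_bilinear_h_check by auto
qed

end

end

theorem theorem3p6:
  fixes A :: "('m::{t2_space, second_countable_topology}, 'e::euclidean_space) chart set"
    and h :: "'m tensor02"
    and N :: "'m connection"
  assumes "smooth_atlas A"
    and "tensor02_field A h"
    and "nondegenerate A h"
    and "symmetric_field A h \<or> skew_symmetric_field A h"
    and "affine_connection A N"
  shows "gbilinear_form A (h_check A h) \<and> gnondegenerate A (h_check A h) \<and>
    gaffine_connection A (nabla_hat A h N) \<and>
    (gquasi_statistical A N (h_check A h) (nabla_hat A h N) \<longleftrightarrow> quasi_statistical A h N)"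
proof -
  interpret nondegenerate_tensor A h
    using assms by unfold_locales
  show ?thesis
    using gbilinear_h_check gnondegenerate_h_check gaffine_nabla_hat gquasi_statistical_iff
      assms(5) by blast
qed

end
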